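(* Let $n\ge1$ and $p$ be integers, let $1\le s\le S<\frac p2$ be integers, let $\sigma>0$, and let $W\subseteq\{1,\dots,S\}$ have $w\ge1$ elements. Let $X_1,\dots,X_n$ be i.i.d. centered Gaussian vectors in $\mathbb{R}^p$ and $\Sigma_n=\frac1n\sum_{k=1}^nX_kX_k^T$. Let $K\in\,]0,1[$ be arbitrary. For $u>0$ put $$t=\max\left\{\sqrt{\frac{u}{2(1-K)}}\sqrt{\frac{w}{n(p-S)}},\;\frac uK\,\frac{w}{n(p-S)}\right\}.$$ Then, when the covariance matrix of the $X_i$ is $I_p$ (so that $\sigma_0=1$), $$\mathbb{P}_{I_p}\left[\varphi_{A_W}(\Sigma_n-I_p)\ge\sigma_0\cdot t\right]\le\exp\left(-\frac u4\right)\quad\text{for all }u>0.$$ Moreover, for any $\Sigma\in\mathcal{F}(s,S,\sigma)$, with diagonal value $\sigma_0$, $$\mathbb{P}_{\Sigma}\left[\varphi_{A_W}(\Sigma_n-\Sigma)\ge\sigma_0\cdot\tilde t\right]\le\exp\left(-\frac u4\right)\quad\text{for all }u>0,$$ where $$\tilde t=\max\left\{\sqrt{\frac{u}{1-K}}\sqrt{\frac{2s+1}{n(p-S)}},\;\frac uK\,\frac{2s+1}{n(p-S)}\right\}\quad\text{if }w=1,$$ and $\tilde t=(2s+1)\,t$ if $w>1$.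
   Context: $\mathbb{P}_\Sigma$ denotes probability when $X_1,\dots,X_n$ are i.i.d. $\mathcal{N}_p(0,\Sigma)$. For a symmetric $p\times p$ matrix $A$, $\varphi_A(B)=\mathrm{Tr}(AB)$. For $1\le j\le p-1$, $A_j$ is the $p\times p$ matrix with entries $[A_j]_{k\ell}=\frac{1}{2(p-j)}$ if $|k-\ell|=j$ and $0$ otherwise, and $A_W=\sum_{j\in W}A_j$. $\mathcal{S}_p^{++}$ is the set of symmetric positive definite $p\times p$ matrices and $\mathcal{T}_p$ the set of $p\times p$ Toeplitz matrices. For $\Sigma\in\mathcal{S}_p^{++}\cap\mathcal{T}_p$ write $\Sigma_{ij}=\sigma_{|i-j|}$, so that $\sigma_0$ is the common diagonal value. For a real $\sigma>0$ and integers $s\le S$ between $1$ and $p-1$, $\mathcal{F}(s,S,\sigma)$ is the set of $\Sigma\in\mathcal{S}_p^{++}\cap\mathcal{T}_p$ for which there exists $\mathbf{S}\subseteq\{1,\dots,S\}$ with $|\mathbf{S}|=s$ such that $|\sigma_j|\ge\sigma$ for all $j\in\mathbf{S}$ and $\sigma_j=0$ for all $j\in\{1,\dots,p-1\}\setminus\mathbf{S}$. The one-sided class $\mathcal{F}_+(s,S,\sigma)$, defined with $\sigma_j\ge\sigma$ instead of $|\sigma_j|\ge\sigma$ on $\mathbf{S}$, is contained in $\mathcal{F}(s,S,\sigma)$. *)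

theory Defs
  imports "HOL-Probability.Probability"
begin

text \<open>
  Vectors in p-dimensional space have type \<open>real ^ 'p\<close> with \<open>p = CARD('p)\<close>. Toeplitz structure
  refers to the order of the indices, so \<open>'p\<close> is a finite linearly ordered type, and its
  elements are numbered increasingly by 1, ..., p. Every \<open>p \<ge> 1\<close> is the size of such a type.
\<close>

definition pos :: "'p::{finite,linorder} \<Rightarrow> nat" where
  "pos k = card {..k}"

definition lag :: "'p::{finite,linorder} \<Rightarrow> 'p \<Rightarrow> nat" where
  "lag k l = nat \<bar>int (pos k) - int (pos l)\<bar>"

lemma strict_mono_pos: "strict_mono (pos :: 'p::{finite,linorder} \<Rightarrow> nat)"
  unfolding strict_mono_def pos_def by (auto intro!: psubset_card_mono)

lemma bij_betw_pos: "bij_betw (pos :: 'p::{finite,linorder} \<Rightarrow> nat) UNIV {1..CARD('p)}"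
proof -
  have inj: "inj (pos :: 'p \<Rightarrow> nat)"
    using strict_mono_pos by (rule strict_mono_imp_inj_on)
  have "range (pos :: 'p \<Rightarrow> nat) \<subseteq> {1..CARD('p)}"
    by (auto simp: pos_def Suc_le_eq card_gt_0_iff intro!: card_mono)
  moreover have "card (range (pos :: 'p \<Rightarrow> nat)) = card {1..CARD('p)}"
    using inj by (simp add: card_image)
  ultimately have "range (pos :: 'p \<Rightarrow> nat) = {1..CARD('p)}"
    by (intro card_subset_eq) auto
  with inj show ?thesis by (simp add: bij_betw_def)
qed

definition sym_pos_def :: "real ^ 'p ^ 'p \<Rightarrow> bool" where
  "sym_pos_def A \<longleftrightarrow> transpose A = A \<and> (\<forall>x. x \<noteq> 0 \<longrightarrow> x \<bullet> (A *v x) > 0)"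

definition toeplitz :: "real ^ ('p::{finite,linorder}) ^ ('p::{finite,linorder}) \<Rightarrow> bool" where
  "toeplitz A \<longleftrightarrow> (\<exists>a :: int \<Rightarrow> real. \<forall>k l. A $ k $ l = a (int (pos k) - int (pos l)))"

text \<open>
  The value on the \<open>j\<close>-th diagonals of a symmetric Toeplitz matrix; meaningful
  for \<open>j < CARD('p)\<close> only.
\<close>

definition toeplitz_coeff :: "real ^ ('p::{finite,linorder}) ^ ('p::{finite,linorder}) \<Rightarrow> nat \<Rightarrow> real" where
  "toeplitz_coeff A j = (THE c. \<forall>k l. lag k l = j \<longrightarrow> A $ k $ l = c)"

lemma toeplitz_coeff_lag:
  assumes "transpose A = A" "toeplitz A"
  shows "A $ k $ l = toeplitz_coeff A (lag k l)"
proof -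
  obtain a :: "int \<Rightarrow> real" where a: "\<And>k l. A $ k $ l = a (int (pos k) - int (pos l))"
    using assms(2) by (auto simp: toeplitz_def)
  have sym: "A $ k $ l = A $ l $ k" for k l
    by (metis assms(1) transpose_def vec_lambda_beta)
  have eq: "A $ k' $ l' = A $ k $ l" if "lag k' l' = lag k l" for k' l'
  proof -
    have "int (pos k') - int (pos l') = int (pos k) - int (pos l) \<or>
          int (pos k') - int (pos l') = int (pos l) - int (pos k)"
      using that by (auto simp: lag_def)
    then show ?thesis by (metis a sym)
  qed
  have "toeplitz_coeff A (lag k l) = A $ k $ l"
    unfolding toeplitz_coeff_def by (rule the_equality) (use eq in blast)+
  then show ?thesis by simp
qed

lemma toeplitz_coeff_mat_1: "toeplitz_coeff (mat 1 :: real ^ ('p::{finite,linorder}) ^ ('p::{finite,linorder})) 0 = 1"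
proof -
  have pos_eq: "pos k = pos l \<longleftrightarrow> k = l" for k l :: 'p
    using strict_mono_pos by (rule strict_mono_eq)
  show ?thesis
    unfolding toeplitz_coeff_def
    by (rule the_equality) (auto simp: lag_def mat_def pos_eq)
qed

definition F_class :: "nat \<Rightarrow> nat \<Rightarrow> real \<Rightarrow> (real ^ ('p::{finite,linorder}) ^ ('p::{finite,linorder})) set" where
  "F_class s S \<sigma> = {\<Sigma>. sym_pos_def \<Sigma> \<and> toeplitz \<Sigma> \<and>
     (\<exists>J. J \<subseteq> {1..S} \<and> card J = s \<and>
        (\<forall>j\<in>J. \<bar>toeplitz_coeff \<Sigma> j\<bar> \<ge> \<sigma>) \<and>
        (\<forall>j\<in>{1..CARD('p) - 1} - J. toeplitz_coeff \<Sigma> j = 0))}"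

definition A_lag :: "nat \<Rightarrow> real ^ ('p::{finite,linorder}) ^ ('p::{finite,linorder})" where
  "A_lag j = (\<chi> k l. if lag k l = j then 1 / (2 * (real CARD('p) - real j)) else 0)"

definition A_set :: "nat set \<Rightarrow> real ^ ('p::{finite,linorder}) ^ ('p::{finite,linorder})" where
  "A_set W = (\<Sum>j\<in>W. A_lag j)"

definition \<phi> :: "real ^ 'p ^ 'p \<Rightarrow> real ^ 'p ^ 'p \<Rightarrow> real" where
  "\<phi> A B = trace (A ** B)"

definition sample_cov :: "nat \<Rightarrow> (nat \<Rightarrow> 'a \<Rightarrow> real ^ 'p) \<Rightarrow> 'a \<Rightarrow> real ^ 'p ^ 'p" where
  "sample_cov n X \<omega> = (1 / real n) *\<^sub>R (\<Sum>m=1..n. \<chi> k l. X m \<omega> $ k * X m \<omega> $ l)"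

text \<open>The centered Gaussian density; it is the law with covariance \<open>\<Sigma>\<close> for positive definite \<open>\<Sigma>\<close>.\<close>

definition gaussian_density :: "real ^ 'p ^ 'p \<Rightarrow> real ^ 'p \<Rightarrow> real" where
  "gaussian_density \<Sigma> x =
     exp (- (x \<bullet> (matrix_inv \<Sigma> *v x)) / 2) / sqrt ((2 * pi) ^ CARD('p) * det \<Sigma>)"

definition iid_gaussian ::
    "'a measure \<Rightarrow> nat \<Rightarrow> real ^ 'p ^ 'p \<Rightarrow> (nat \<Rightarrow> 'a \<Rightarrow> real ^ 'p) \<Rightarrow> bool" where
  "iid_gaussian M n \<Sigma> X \<longleftrightarrow>
     prob_space M \<and>
     prob_space.indep_vars M (\<lambda>_. borel) X {1..n} \<and>
     (\<forall>m\<in>{1..n}. distributed M lborel (X m) (\<lambda>x. ennreal (gaussian_density \<Sigma> x)))"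

end

theory Submission
  imports Defs
begin

text \<open>
  Two applications of the spectral theorem give an invertible \<open>T\<close> with \<open>T T\<^sup>t = \<Sigma>\<close> and
  \<open>T\<^sup>t A T = diag(d)\<close>, so that under \<open>x = T z\<close> the form \<open>x \<bullet> A x\<close> becomes \<open>\<Sum>i. d\<^sub>i z\<^sub>i\<^sup>2\<close> with
  independent standard normal \<open>z\<^sub>i\<close>. Its Laplace transform is \<open>\<Prod>i. (1 - 2 \<theta> d\<^sub>i) powr (-1/2)\<close>, and
  \<open>- ln (1 - x) - x \<le> x\<^sup>2 / (2 (1 - K))\<close> for \<open>x \<le> K\<close> turns the Chernoff bound into a Bernstein
  bound governed by the sum of squares \<open>tr (A \<Sigma> A \<Sigma>)\<close> of the \<open>d\<^sub>i\<close> and by their maximum. The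
  maximum is at most the maximal absolute row sum of \<open>A \<Sigma>\<close>. The absolute row sums of \<open>\<Sigma>\<close> are
  bounded by \<open>r = \<sigma>\<^sub>0 (2 s + 1)\<close>, which gives \<open>tr (A \<Sigma> A \<Sigma>) \<le> r tr (A A \<Sigma>)\<close>; for \<open>w > 1\<close> this is
  at most \<open>r\<^sup>2 tr (A A)\<close>, while for \<open>w = 1\<close> the better bound \<open>tr (A A \<Sigma>) \<le> \<sigma>\<^sub>0 / (p - S)\<close> holds,
  since the entries of \<open>A\<close> are nonnegative with total sum at most 1 and row sums at most \<open>1 / (p - S)\<close>.
\<close>

section \<open>Spectral theorem\<close>

text \<open>\<open>v\<close> maximises the form \<open>x \<bullet> f x\<close> over the compact unit
  sphere of \<open>S\<close>. The residual \<open>f v - c v\<close> again lies in \<open>S\<close>,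
  so it is an admissible direction of variation, and optimality of \<open>v\<close> forces it to
  vanish.\<close>

lemma self_adjoint_eigenvector:
  fixes f :: "'a::euclidean_space \<Rightarrow> 'a"
  assumes f: "linear f" and sym: "\<And>x y. x \<bullet> f y = f x \<bullet> y"
    and S: "subspace S" "\<And>x. x \<in> S \<Longrightarrow> f x \<in> S" "S \<noteq> {0}"
  obtains v c where "v \<in> S" "norm v = 1" "f v = c *\<^sub>R v"
proof -
  define K where "K = S \<inter> sphere 0 1"
  have "compact K"
    unfolding K_def using closed_subspace[OF S(1)] by (intro closed_Int_compact) auto
  moreover obtain w where w: "w \<in> S" "w \<noteq> 0"
    using S(1,3) subspace_0 by fastforce
  have "w /\<^sub>R norm w \<in> K"
    using w S(1) by (simp add: K_def subspace_scale)
  then have "K \<noteq> {}" by auto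
  moreover have "continuous_on K (\<lambda>x. x \<bullet> f x)"
    using f by (intro continuous_intros linear_continuous_on) (simp add: linear_conv_bounded_linear)
  ultimately obtain v where v: "v \<in> K" and max: "\<And>y. y \<in> K \<Longrightarrow> y \<bullet> f y \<le> v \<bullet> f v"
    using continuous_attains_sup by metis
  define c where "c = v \<bullet> f v"
  have vS: "v \<in> S" and nv: "norm v = 1" "v \<bullet> v = 1"
    using v by (auto simp: K_def norm_eq_1)
  \<comment> \<open>By homogeneity the maximum on the sphere controls the form on all of
    \<open>S\<close>, so that variations \<open>v + t g\<close> can be tested without renormalising
    them.\<close>
  have le: "y \<bullet> f y \<le> c * (y \<bullet> y)" if "y \<in> S" for y
  proof (cases "y = 0")
    case True then show ?thesis using linear_0[OF f] by simp
  next
    case False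
    then have "y /\<^sub>R norm y \<in> K"
      using that S(1) by (simp add: K_def subspace_scale)
    from max[OF this] have "(y \<bullet> f y) / (norm y)\<^sup>2 \<le> c"
      by (simp add: c_def linear_scale[OF f] power2_eq_square divide_inverse mult_ac)
    then show ?thesis
      using False by (simp add: field_simps power2_norm_eq_inner)
  qed
  define g where "g = f v - c *\<^sub>R v"
  have gS: "g \<in> S"
    unfolding g_def using S vS by (simp add: subspace_diff subspace_scale)
  have gg: "g \<bullet> g = 0"
  proof (rule ccontr)
    assume "g \<bullet> g \<noteq> 0"
    then have pos: "g \<bullet> g > 0" by simp
    \<comment> \<open>first-order optimality of \<open>v\<close> in the direction \<open>g\<close>\<close>
    have key: "2 * t * (g \<bullet> g) \<le> t\<^sup>2 * (c * (g \<bullet> g) - g \<bullet> f g)" for t :: real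
    proof -
      have "v + t *\<^sub>R g \<in> S"
        using S(1) vS gS by (simp add: subspace_add subspace_scale)
      from le[OF this] have "v \<bullet> f v + 2 * t * (g \<bullet> f v) + t\<^sup>2 * (g \<bullet> f g)
          \<le> c * (v \<bullet> v + 2 * t * (g \<bullet> v) + t\<^sup>2 * (g \<bullet> g))"
        using sym[of v g]
        by (simp add: linear_add[OF f] linear_scale[OF f] algebra_simps inner_commute power2_eq_square)
      then have "2 * t * (g \<bullet> f v - c * (g \<bullet> v)) \<le> t\<^sup>2 * (c * (g \<bullet> g) - g \<bullet> f g)"
        by (simp add: nv c_def algebra_simps)
      moreover have "g \<bullet> f v - c * (g \<bullet> v) = g \<bullet> g"
        by (simp add: g_def inner_diff_right)
      ultimately show ?thesis by simp
    qed
    \<comment> \<open>\<open>D\<close> is a positive upper bound for the coefficient of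
      \<open>t^2\<close>. At \<open>t = (g \<bullet> g) / D\<close> the inequality
      \<open>key\<close> would give \<open>2 |g|^4 / D <= |g|^4 / D\<close>.\<close>
    define D where "D = \<bar>c * (g \<bullet> g) - g \<bullet> f g\<bar> + 1"
    have D: "D > 0" "c * (g \<bullet> g) - g \<bullet> f g \<le> D" by (auto simp: D_def)
    have "2 * ((g \<bullet> g) / D) * (g \<bullet> g) \<le> ((g \<bullet> g) / D)\<^sup>2 * D"
      using key[of "(g \<bullet> g) / D"] D(2) by (meson mult_left_mono order_trans zero_le_power2)
    then show False
      using D(1) mult_pos_pos[OF pos pos] by (simp add: field_simps power2_eq_square)
  qed
  then have "f v = c *\<^sub>R v" by (simp add: g_def)
  with that vS nv show ?thesis by blast
qed

text \<open>Induction on the dimension: one eigenvector \<open>v\<close> is split off, and its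
  orthogonal complement inside \<open>S\<close> is invariant because
  \<open>v \<bullet> f x = f v \<bullet> x = c (v \<bullet> x)\<close>.\<close>

lemma self_adjoint_orthonormal_eigenbasis:
  fixes f :: "'a::euclidean_space \<Rightarrow> 'a"
  assumes f: "linear f" and sym: "\<And>x y. x \<bullet> f y = f x \<bullet> y"
    and S: "subspace S" "\<And>x. x \<in> S \<Longrightarrow> f x \<in> S"
  shows "\<exists>B. finite B \<and> B \<subseteq> S \<and> span B = S \<and> pairwise orthogonal B \<and> (\<forall>b\<in>B. norm b = 1 \<and> (\<exists>c. f b = c *\<^sub>R b))"
  using S
proof (induction "dim S" arbitrary: S rule: less_induct)
  case less
  show ?case
  proof (cases "S = {0}")
    case True
    then show ?thesis by (intro exI[of _ "{}"]) auto
  next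
    case False
    obtain v c where v: "v \<in> S" "norm v = 1" "f v = c *\<^sub>R v"
      using self_adjoint_eigenvector[OF f sym less.prems False] by blast
    have vv: "v \<bullet> v = 1" using v(2) by (simp add: norm_eq_1)
    define S' where "S' = S \<inter> {y. orthogonal v y}"
    have S': "subspace S'"
      unfolding S'_def using less.prems(1) subspace_orthogonal_to_vector by (rule subspace_inter)
    have inv: "f x \<in> S'" if "x \<in> S'" for x
      using that less.prems(2) sym[of v x] v(3) by (auto simp: S'_def orthogonal_def)
    have "v \<notin> S'" using vv by (simp add: S'_def orthogonal_def)
    then have "S' \<subset> S" using v(1) by (auto simp: S'_def)
    then have "dim S' < dim S"
      using dim_psubset[of S' S] S' less.prems(1) by (metis span_eq_iff)
    from less.hyps[OF this S' inv] obtain B where B: "finite B" "B \<subseteq> S'" "span B = S'"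
      "pairwise orthogonal B" "\<forall>b\<in>B. norm b = 1 \<and> (\<exists>c. f b = c *\<^sub>R b)"
      by auto
    have "span (insert v B) = S"
    proof
      show "span (insert v B) \<subseteq> S"
        using v(1) B(2) less.prems(1) by (intro span_minimal) (auto simp: S'_def)
      show "S \<subseteq> span (insert v B)"
      proof
        fix x assume x: "x \<in> S"
        have "x - (v \<bullet> x) *\<^sub>R v \<in> S'"
          using x v(1) less.prems(1) vv
          by (auto simp: S'_def orthogonal_def inner_diff_right intro!: subspace_diff subspace_scale)
        then have "x - (v \<bullet> x) *\<^sub>R v \<in> span B" using B(3) by simp
        then show "x \<in> span (insert v B)" unfolding span_insert by blast
      qed
    qed
    moreover have "pairwise orthogonal (insert v B)"
      using B(2,4) by (auto simp: pairwise_insert S'_def orthogonal_commute)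
    ultimately show ?thesis
      using B v less.prems \<open>S' \<subset> S\<close> by (intro exI[of _ "insert v B"]) auto
  qed
qed

lemma transpose_mult_component:
  fixes A :: "real^'m^'n" and U :: "real^'k^'m"
  shows "(transpose V ** A ** U) $ i $ j = column i V \<bullet> (A *v column j U)"
proof -
  have "(transpose V ** A ** U) $ i $ j = (transpose V ** (A ** U)) $ i $ j"
    by (simp add: matrix_mul_assoc)
  also have "\<dots> = (\<Sum>k\<in>UNIV. V $ k $ i * (\<Sum>l\<in>UNIV. A $ k $ l * U $ l $ j))"
    by (simp add: matrix_matrix_mult_def transpose_def)
  also have "\<dots> = column i V \<bullet> (A *v column j U)"
    by (simp add: inner_vec_def column_def matrix_vector_mult_def)
  finally show ?thesis .
qed

lemma inner_symmetric_matrix: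
  fixes A :: "real^'n^'n"
  assumes "transpose A = A"
  shows "x \<bullet> (A *v y) = (A *v x) \<bullet> y"
  using assms by (metis dot_lmul_matrix transpose_matrix_vector)

text \<open>An orthonormal eigenbasis has as many elements as the index type, so it can be
  enumerated by the indices and used as the columns of \<open>U\<close>.\<close>

lemma symmetric_matrix_diagonalization:
  fixes A :: "real^'n^'n"
  assumes "transpose A = A"
  obtains U :: "real^'n^'n" and d :: "real^'n"
  where "orthogonal_matrix U" "transpose U ** A ** U = (\<chi> i j. if i = j then d $ i else 0)"
proof -
  note sym = inner_symmetric_matrix[OF assms]
  obtain B where B: "finite B" "span B = UNIV" "pairwise orthogonal B"
      "\<And>b. b \<in> B \<Longrightarrow> norm b = 1" "\<And>b. b \<in> B \<Longrightarrow> \<exists>c. A *v b = c *\<^sub>R b"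
    using self_adjoint_orthonormal_eigenbasis[of "(*v) A" UNIV] sym by auto
  have "independent B"
    using B(3,4) by (intro pairwise_orthogonal_independent) force+
  then have "card B = CARD('n)"
    using B(2) by (metis dim_UNIV dim_span_eq_card_independent DIM_cart DIM_real mult.right_neutral)
  then obtain h where h: "bij_betw h (UNIV :: 'n set) B"
    using finite_same_card_bij[of "UNIV :: 'n set" B] B(1) by auto
  define U :: "real^'n^'n" where "U = (\<chi> k i. h i $ k)"
  have col: "column i U = h i" for i
    by (simp add: U_def column_def vec_eq_iff)
  have hB: "h i \<in> B" for i using h by (auto simp: bij_betw_def)
  have orth: "h i \<bullet> h j = 0" if "i \<noteq> j" for i j
    using that h B(3) hB by (metis bij_betw_def injD pairwise_def orthogonal_def)
  obtain e where e: "\<And>i. A *v h i = e i *\<^sub>R h i" using B(5)[OF hB] by metis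
  have "orthogonal_matrix U"
    unfolding orthogonal_matrix_orthonormal_columns col orthogonal_def using B(4)[OF hB] orth by blast
  moreover have "transpose U ** A ** U = (\<chi> i j. if i = j then (\<chi> i. e i) $ i else 0)"
    using B(4)[OF hB] orth by (simp add: vec_eq_iff transpose_mult_component col e norm_eq_1)
  ultimately show ?thesis using that by blast
qed

text \<open>If \<open>R\<close> is the square root of the diagonal form of \<Sigma> in its
  eigenbasis \<open>Q\<close>, then \<open>Q R\<close> times its transpose is \<Sigma>, and this
  survives right multiplication by any orthogonal \<open>U\<close>. That freedom is spent on
  diagonalising \<open>(Q R)^t A (Q R)\<close>.\<close>

lemma pos_def_congruence_diagonalization:
  fixes A \<Sigma> :: "real^'n^'n"
  assumes A: "transpose A = A" and \<Sigma>: "sym_pos_def \<Sigma>"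
  obtains T :: "real^'n^'n" and d :: "real^'n"
  where "invertible T" "T ** transpose T = \<Sigma>" "transpose T ** A ** T = (\<chi> i j. if i = j then d $ i else 0)"
proof -
  have \<Sigma>t: "transpose \<Sigma> = \<Sigma>" and pd: "\<And>x. x \<noteq> 0 \<Longrightarrow> x \<bullet> (\<Sigma> *v x) > 0"
    using \<Sigma> by (auto simp: sym_pos_def_def)
  obtain Q :: "real^'n^'n" and q :: "real^'n" where Q: "orthogonal_matrix Q"
      "transpose Q ** \<Sigma> ** Q = (\<chi> i j. if i = j then q $ i else 0)"
    using symmetric_matrix_diagonalization[OF \<Sigma>t] by blast
  have QQ: "Q ** transpose Q = mat 1" "transpose Q ** Q = mat 1"
    using Q(1) by (auto simp: orthogonal_matrix_def)
  \<comment> \<open>An eigenvalue is the form of \<Sigma> at a nonzero column of \<open>Q\<close>.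
    Positivity makes the entrywise root below a true square root and \<open>R\<close>
    invertible.\<close>
  have q: "q $ i > 0" for i
  proof -
    have "q $ i = column i Q \<bullet> (\<Sigma> *v column i Q)"
      using arg_cong[OF Q(2), of "\<lambda>B. B $ i $ i"] by (simp add: transpose_mult_component)
    moreover have "column i Q \<noteq> 0"
      using Q(1) by (metis orthogonal_matrix_orthonormal_columns norm_zero zero_neq_one)
    ultimately show ?thesis using pd by simp
  qed
  define R :: "real^'n^'n" where "R = (\<chi> i j. if i = j then sqrt (q $ i) else 0)"
  have Rt: "transpose R = R" by (auto simp: R_def transpose_def vec_eq_iff)
  have "R ** R = (\<chi> i j. if i = j then q $ i else 0)"
    using q by (auto simp: R_def matrix_matrix_mult_def vec_eq_iff if_distrib[of "\<lambda>x. x * _"] less_imp_le cong: if_cong)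
  then have R: "R ** R = transpose Q ** \<Sigma> ** Q" using Q(2) by simp
  have "det R = (\<Prod>i\<in>UNIV. sqrt (q $ i))"
    by (subst det_diagonal) (auto simp: R_def)
  then have "det R \<noteq> 0" using q by (auto simp: less_imp_neq[symmetric])
  then have invR: "invertible R" by (simp add: invertible_det_nz)
  define C where "C = transpose (Q ** R) ** A ** (Q ** R)"
  have "transpose C = C"
    by (simp add: C_def matrix_transpose_mul A matrix_mul_assoc)
  then obtain U :: "real^'n^'n" and d :: "real^'n" where U: "orthogonal_matrix U"
      "transpose U ** C ** U = (\<chi> i j. if i = j then d $ i else 0)"
    using symmetric_matrix_diagonalization by blast
  have UU: "U ** transpose U = mat 1" "transpose U ** U = mat 1"
    using U(1) by (auto simp: orthogonal_matrix_def)
  define T where "T = Q ** R ** U"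
  have "T ** transpose T = Q ** R ** (U ** transpose U) ** R ** transpose Q"
    by (simp add: T_def matrix_transpose_mul Rt matrix_mul_assoc)
  also have "\<dots> = Q ** (R ** R) ** transpose Q"
    unfolding UU by (simp add: matrix_mul_assoc)
  also have "\<dots> = (Q ** transpose Q) ** \<Sigma> ** (Q ** transpose Q)"
    by (simp add: R matrix_mul_assoc)
  finally have "T ** transpose T = \<Sigma>" by (simp add: QQ)
  moreover have "transpose T ** A ** T = (\<chi> i j. if i = j then d $ i else 0)"
    using U(2) by (simp add: T_def C_def matrix_transpose_mul matrix_mul_assoc)
  moreover have "invertible T"
    unfolding T_def using invR QQ UU by (metis invertible_def invertible_mult)
  ultimately show ?thesis using that by blast
qed

section \<open>Laplace transform of a Gaussian quadratic form\<close>

lemma nn_integral_lborel_translation: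
  fixes f :: "'a::euclidean_space \<Rightarrow> ennreal"
  assumes [measurable]: "f \<in> borel_measurable borel"
  shows "(\<integral>\<^sup>+x. f (a + x) \<partial>lborel) = (\<integral>\<^sup>+x. f x \<partial>lborel)"
proof -
  have "(\<integral>\<^sup>+x. f x \<partial>lborel) = (\<integral>\<^sup>+x. f x \<partial>distr lborel borel ((+) a))"
    by (simp add: lborel_distr_plus)
  also have "\<dots> = (\<integral>\<^sup>+x. f (a + x) \<partial>lborel)"
    by (subst nn_integral_distr) auto
  finally show ?thesis by simp
qed

text \<open>
  By Fubini and translation invariance alone, a linear substitution multiplies all integrals by the same
  constant. The constant is never needed, because the Gaussian densities are normalised; the library's
  change of variables would require a well-ordered index type.
\<close>

lemma nn_integral_linear_substitution_ratio:
  fixes T T' :: "'a::euclidean_space \<Rightarrow> 'a" and f g :: "'a \<Rightarrow> ennreal"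
  assumes T: "linear T" and T': "\<And>x. T (T' x) = x"
    and [measurable]: "f \<in> borel_measurable borel" "g \<in> borel_measurable borel"
    and even: "\<And>x. g (- x) = g x"
  shows "(\<integral>\<^sup>+x. f (T x) \<partial>lborel) * (\<integral>\<^sup>+x. g x \<partial>lborel)
       = (\<integral>\<^sup>+x. f x \<partial>lborel) * (\<integral>\<^sup>+x. g (T x) \<partial>lborel)"
proof -
  have [measurable]: "T \<in> borel_measurable borel"
    using T by (intro borel_measurable_continuous_onI linear_continuous_on) (simp add: linear_conv_bounded_linear)
  have "(\<integral>\<^sup>+x. f (T x) \<partial>lborel) * (\<integral>\<^sup>+x. g x \<partial>lborel)
      = (\<integral>\<^sup>+y. (\<integral>\<^sup>+x. f (T x) \<partial>lborel) * g y \<partial>lborel)"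
    by (simp add: nn_integral_cmult)
  \<comment> \<open>The inner integral is shifted by \<open>T' y\<close>, which turns
    \<open>T x\<close> into \<open>y + T x\<close>. After exchanging the integrals, \<open>y\<close>
    can be shifted in turn.\<close>
  also have "\<dots> = (\<integral>\<^sup>+y. (\<integral>\<^sup>+x. f (T (T' y + x)) \<partial>lborel) * g y \<partial>lborel)"
    by (subst nn_integral_lborel_translation[of "\<lambda>x. f (T x)"]) auto
  also have "\<dots> = (\<integral>\<^sup>+y. \<integral>\<^sup>+x. f (y + T x) * g y \<partial>lborel \<partial>lborel)"
    by (simp add: linear_add[OF T] T' nn_integral_multc)
  also have "\<dots> = (\<integral>\<^sup>+x. \<integral>\<^sup>+y. f (y + T x) * g y \<partial>lborel \<partial>lborel)"
    by (rule lborel_pair.Fubini') measurable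
  also have "\<dots> = (\<integral>\<^sup>+x. \<integral>\<^sup>+y. f y * g (y - T x) \<partial>lborel \<partial>lborel)"
  proof (rule nn_integral_cong)
    fix x
    have "(\<integral>\<^sup>+y. f y * g (y - T x) \<partial>lborel) = (\<integral>\<^sup>+y. f (T x + y) * g (T x + y - T x) \<partial>lborel)"
      by (subst nn_integral_lborel_translation[of "\<lambda>y. f y * g (y - T x)"]) auto
    then show "(\<integral>\<^sup>+y. f (y + T x) * g y \<partial>lborel) = (\<integral>\<^sup>+y. f y * g (y - T x) \<partial>lborel)"
      by (simp add: add.commute)
  qed
  also have "\<dots> = (\<integral>\<^sup>+y. \<integral>\<^sup>+x. f y * g (y - T x) \<partial>lborel \<partial>lborel)"
    by (rule lborel_pair.Fubini') measurable
  also have "\<dots> = (\<integral>\<^sup>+y. f y * (\<integral>\<^sup>+x. g (y - T x) \<partial>lborel) \<partial>lborel)"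
    by (simp add: nn_integral_cmult)
  \<comment> \<open>A second shift by \<open>T' y\<close> leaves \<open>g (- T x)\<close>, and
    evenness of \<open>g\<close> removes the sign.\<close>
  also have "\<dots> = (\<integral>\<^sup>+y. f y * (\<integral>\<^sup>+x. g (y - T (T' y + x)) \<partial>lborel) \<partial>lborel)"
    by (subst nn_integral_lborel_translation[of "\<lambda>x. g (_ - T x)"]) auto
  also have "\<dots> = (\<integral>\<^sup>+y. f y * (\<integral>\<^sup>+x. g (T x) \<partial>lborel) \<partial>lborel)"
    by (simp add: linear_add[OF T] T' even)
  also have "\<dots> = (\<integral>\<^sup>+x. f x \<partial>lborel) * (\<integral>\<^sup>+x. g (T x) \<partial>lborel)"
    by (simp add: nn_integral_multc)
  finally show ?thesis .
qed

lemma nn_integral_gaussian_1: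
  assumes "c > 0"
  shows "(\<integral>\<^sup>+x. ennreal (exp (- (c * x\<^sup>2 / 2))) \<partial>lborel) = ennreal (sqrt (2 * pi) / sqrt c)"
proof -
  have eq: "exp (- (c * x\<^sup>2 / 2)) = sqrt (2 * pi) / sqrt c * normal_density 0 (1 / sqrt c) x" for x
    using assms by (simp add: normal_density_def real_sqrt_divide field_simps)
  have "(\<integral>\<^sup>+x. ennreal (normal_density 0 (1 / sqrt c) x) \<partial>lborel) = 1"
    using assms by (subst nn_integral_eq_integral) auto
  then show ?thesis
    unfolding eq using assms by (subst ennreal_mult) (auto simp: nn_integral_cmult)
qed

text \<open>The exponential of a diagonal form factorises over the standard basis, so the integral
  is a product of one-dimensional ones.\<close>

lemma nn_integral_gaussian_diagonal:
  fixes c :: "real^'n"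
  assumes "\<And>i. c $ i > 0"
  shows "(\<integral>\<^sup>+x. ennreal (exp (- (\<Sum>i\<in>UNIV. c $ i * (x $ i)\<^sup>2) / 2)) \<partial>(lborel :: (real^'n) measure))
       = ennreal (\<Prod>i\<in>UNIV. sqrt (2 * pi) / sqrt (c $ i))"
proof -
  have Basis: "(Basis :: (real^'n) set) = range (\<lambda>i. axis i 1)"
    by (auto simp: Basis_vec_def)
  have inj: "inj (\<lambda>i. axis i 1 :: real^'n)"
    by (auto simp: inj_on_def axis_eq_axis)
  have "(\<integral>\<^sup>+x. ennreal (exp (- (\<Sum>i\<in>UNIV. c $ i * (x $ i)\<^sup>2) / 2)) \<partial>(lborel :: (real^'n) measure))
      = (\<integral>\<^sup>+x. (\<Prod>b\<in>Basis. ennreal (exp (- ((c \<bullet> b) * (x \<bullet> b)\<^sup>2 / 2)))) \<partial>(lborel :: (real^'n) measure))"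
    by (simp add: Basis prod.reindex[OF inj] inner_axis prod_ennreal exp_sum[symmetric] sum_negf sum_divide_distrib)
  also have "\<dots> = (\<Prod>b\<in>Basis. (\<integral>\<^sup>+x. ennreal (exp (- ((c \<bullet> b) * x\<^sup>2 / 2))) \<partial>lborel))"
    by (rule nn_integral_lborel_prod) auto
  also have "\<dots> = (\<Prod>i\<in>UNIV. ennreal (sqrt (2 * pi) / sqrt (c $ i)))"
    using assms by (simp add: Basis prod.reindex[OF inj] inner_axis nn_integral_gaussian_1)
  finally show ?thesis
    using assms by (simp add: prod_ennreal less_imp_le)
qed

lemma borel_measurable_quadratic_form [measurable]:
  fixes A :: "real^'n^'n"
  shows "(\<lambda>x. x \<bullet> (A *v x)) \<in> borel_measurable borel"
  by (intro borel_measurable_continuous_onI continuous_intros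
      linear_continuous_on[unfolded linear_conv_bounded_linear[symmetric]]) auto

text \<open>\<open>matrix_inv\<close> chooses some two-sided inverse; a right inverse of a square
  matrix is two-sided and therefore equal to the chosen one.\<close>

lemma matrix_inv_unique:
  fixes A B :: "real^'n^'n"
  assumes "A ** B = mat 1"
  shows "matrix_inv A = B"
proof -
  have BA: "B ** A = mat 1" using assms by (simp add: matrix_left_right_inverse)
  have "A ** matrix_inv A = mat 1 \<and> matrix_inv A ** A = mat 1"
    unfolding matrix_inv_def by (rule someI[of _ B]) (simp add: assms BA)
  then show ?thesis
    by (metis BA matrix_mul_assoc matrix_mul_lid matrix_mul_rid)
qed

text \<open>Under \<open>x = T z\<close> both quadratic forms become diagonal and the integral
  factorises; \<open>small\<close> keeps every coefficient \<open>1 - 2 * \<theta> * d $ i\<close>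
  positive. The Jacobian is not computed: the parameter value 0, where \<open>norm\<close> fixes the
  integral, calibrates the scaling constant.\<close>

lemma gaussian_density_quadratic_mgf:
  fixes A \<Sigma> T :: "real^'n^'n" and d :: "real^'n"
  assumes T: "invertible T" "T ** transpose T = \<Sigma>"
    and diag: "transpose T ** A ** T = (\<chi> i j. if i = j then d $ i else 0)"
    and small: "\<And>i. 2 * \<theta> * d $ i < 1"
    and norm: "(\<integral>\<^sup>+x. ennreal (gaussian_density \<Sigma> x) \<partial>lborel) = 1"
  shows "(\<integral>\<^sup>+x. ennreal (gaussian_density \<Sigma> x) * ennreal (exp (\<theta> * (x \<bullet> (A *v x)))) \<partial>lborel)
       = ennreal (\<Prod>i\<in>UNIV. 1 / sqrt (1 - 2 * \<theta> * d $ i))"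
proof -
  define \<kappa> where "\<kappa> = 1 / sqrt ((2 * pi) ^ CARD('n) * det \<Sigma>)"
  have "det \<Sigma> = (det T)\<^sup>2"
    using T(2) by (auto simp: det_mul power2_eq_square)
  moreover have "det T \<noteq> 0" using T(1) by (simp add: invertible_det_nz)
  ultimately have \<kappa>: "\<kappa> > 0" by (simp add: \<kappa>_def)
  obtain T' where T': "T ** T' = mat 1" "T' ** T = mat 1"
    using T(1) by (auto simp: invertible_def)
  have "\<Sigma> ** (transpose T' ** T') = mat 1"
  proof -
    have "\<Sigma> ** (transpose T' ** T') = T ** transpose (T' ** T) ** T'"
      by (simp add: T(2)[symmetric] matrix_transpose_mul matrix_mul_assoc)
    then show ?thesis using T' by simp
  qed
  then have inv: "matrix_inv \<Sigma> = transpose T' ** T'"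
    by (rule matrix_inv_unique)
  \<comment> \<open>The integrand without its constant, with a free parameter: it is used at
    \<theta> and, for the calibration, at 0.\<close>
  define E where "E \<tau> x = ennreal (exp (\<tau> * (x \<bullet> (A *v x)) - x \<bullet> (matrix_inv \<Sigma> *v x) / 2))" for \<tau> and x :: "real^'n"
  have E_meas [measurable]: "E \<tau> \<in> borel_measurable borel" for \<tau>
    unfolding E_def by measurable
  have dens: "ennreal (gaussian_density \<Sigma> x) * ennreal (exp (\<tau> * (x \<bullet> (A *v x)))) = ennreal \<kappa> * E \<tau> x" for x \<tau>
  proof -
    have "gaussian_density \<Sigma> x = \<kappa> * exp (- (x \<bullet> (matrix_inv \<Sigma> *v x) / 2))"
      by (simp add: gaussian_density_def \<kappa>_def)
    then show ?thesis
      using \<kappa> by (simp add: E_def ennreal_mult[symmetric] mult.assoc exp_add[symmetric])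
  qed
  have qA: "(T *v z) \<bullet> (A *v (T *v z)) = (\<Sum>i\<in>UNIV. d $ i * (z $ i)\<^sup>2)" for z
  proof -
    have "(T *v z) \<bullet> (A *v (T *v z)) = z \<bullet> ((transpose T ** A ** T) *v z)"
      by (simp add: matrix_vector_mul_assoc[symmetric] dot_lmul_matrix transpose_matrix_vector inner_commute) (metis dot_lmul_matrix inner_commute transpose_matrix_vector)
    also have "\<dots> = (\<Sum>i\<in>UNIV. d $ i * (z $ i)\<^sup>2)"
      by (simp add: diag inner_vec_def matrix_vector_mult_def if_distrib[of "\<lambda>x. x * _"] cong: if_cong)
         (simp add: power2_eq_square mult_ac)
    finally show ?thesis .
  qed
  have qI: "(T *v z) \<bullet> (matrix_inv \<Sigma> *v (T *v z)) = (\<Sum>i\<in>UNIV. (z $ i)\<^sup>2)" for z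
  proof -
    have "(T *v z) \<bullet> (matrix_inv \<Sigma> *v (T *v z)) = (T' *v (T *v z)) \<bullet> (T' *v (T *v z))"
      unfolding inv by (metis dot_lmul_matrix matrix_vector_mul_assoc transpose_matrix_vector transpose_transpose)
    then show ?thesis
      by (simp add: matrix_vector_mul_assoc T' inner_vec_def power2_eq_square)
  qed
  have ET: "E \<tau> (T *v z) = ennreal (exp (- (\<Sum>i\<in>UNIV. (\<chi> i. 1 - 2 * \<tau> * d $ i) $ i * (z $ i)\<^sup>2) / 2))" for \<tau> z
    unfolding E_def qA qI by (simp add: algebra_simps sum_subtractf sum_distrib_left sum_divide_distrib diff_divide_distrib)
  \<comment> \<open>The comparison function of the substitution: it is even and has a known positive
    finite integral.\<close>
  define g where "g z = ennreal (exp (- (\<Sum>i\<in>UNIV. (\<chi> i. 1) $ i * (z $ i)\<^sup>2) / 2))" for z :: "real^'n"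
  have [measurable]: "g \<in> borel_measurable borel" unfolding g_def by measurable
  define G where "G = (\<Prod>i\<in>(UNIV::'n set). sqrt (2 * pi))"
  have G: "G > 0" by (simp add: G_def)
  have int_g: "(\<integral>\<^sup>+x. g x \<partial>lborel) = ennreal G"
    unfolding g_def by (subst nn_integral_gaussian_diagonal) (auto simp: G_def)
  have int_ET: "(\<integral>\<^sup>+x. E \<tau> (T *v x) \<partial>lborel) = ennreal (G * (\<Prod>i\<in>UNIV. 1 / sqrt (1 - 2 * \<tau> * d $ i)))"
    if "\<And>i. 2 * \<tau> * d $ i < 1" for \<tau>
    unfolding ET using that by (subst nn_integral_gaussian_diagonal) (simp_all add: G_def prod_dividef)
  define C where "C = (\<integral>\<^sup>+x. g (T *v x) \<partial>lborel)"
  have ratio: "(\<integral>\<^sup>+x. E \<tau> (T *v x) \<partial>lborel) * ennreal G = (\<integral>\<^sup>+x. E \<tau> x \<partial>lborel) * C" for \<tau>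
    unfolding int_g[symmetric] C_def
    by (rule nn_integral_linear_substitution_ratio[where T' = "(*v) T'"])
       (auto simp: matrix_vector_mul_assoc T' g_def)
  have norm': "ennreal \<kappa> * (\<integral>\<^sup>+x. E 0 x \<partial>lborel) = 1"
    using norm dens[of _ 0] by (simp add: nn_integral_cmult[symmetric])
  \<comment> \<open>At parameter 0 the product over \<open>d\<close> is 1, so the normalisation
    yields \<open>C = \<kappa> G^2\<close>. This is positive and finite, hence it can be cancelled
    at \<theta>.\<close>
  have "ennreal \<kappa> * (ennreal G * ennreal G) = ennreal \<kappa> * (\<integral>\<^sup>+x. E 0 x \<partial>lborel) * C"
    using ratio[of 0] int_ET[of 0] by (simp add: mult.assoc)
  then have C: "C = ennreal (\<kappa> * G * G)"
    using norm' \<kappa> G by (simp add: ennreal_mult mult.assoc)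
  have "ennreal \<kappa> * (\<integral>\<^sup>+x. E \<theta> x \<partial>lborel) * C
      = ennreal (\<Prod>i\<in>UNIV. 1 / sqrt (1 - 2 * \<theta> * d $ i)) * C"
  proof -
    have P: "0 \<le> (\<Prod>i\<in>UNIV. 1 / sqrt (1 - 2 * \<theta> * d $ i))"
      using small by (intro prod_nonneg) (simp add: less_imp_le)
    have "ennreal \<kappa> * (\<integral>\<^sup>+x. E \<theta> x \<partial>lborel) * C
       = ennreal \<kappa> * (ennreal (G * (\<Prod>i\<in>UNIV. 1 / sqrt (1 - 2 * \<theta> * d $ i))) * ennreal G)"
      using ratio[of \<theta>] int_ET[of \<theta>] small by (simp add: mult.assoc)
    also have "\<dots> = ennreal (\<Prod>i\<in>UNIV. 1 / sqrt (1 - 2 * \<theta> * d $ i)) * C"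
      unfolding C using \<kappa> G P by (simp add: ennreal_mult[symmetric] mult_ac)
    finally show ?thesis .
  qed
  then have "ennreal \<kappa> * (\<integral>\<^sup>+x. E \<theta> x \<partial>lborel) = ennreal (\<Prod>i\<in>UNIV. 1 / sqrt (1 - 2 * \<theta> * d $ i))"
    unfolding C mult_right_ennreal_cancel using mult_pos_pos[OF mult_pos_pos[OF \<kappa> G] G] by linarith
  then show ?thesis
    unfolding dens by (simp add: nn_integral_cmult)
qed

section \<open>Exponential bound for the centred quadratic form\<close>

lemma neg_ln_one_minus_bound:
  fixes x K :: real
  assumes "x \<le> K" "0 \<le> K" "K < 1"
  shows "- ln (1 - x) - x \<le> x\<^sup>2 / (2 * (1 - K))"
proof -
  \<comment> \<open>The right side minus the left side of the claim. For \<open>y <= K\<close> its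
    derivative is nonnegative when \<open>y >= 0\<close> and nonpositive when \<open>y <= 0\<close>,
    so its minimum is \<open>g 0 = 0\<close>. Negative arguments matter since \<open>d\<close> may
    have either sign.\<close>
  define g where "g y = 1 / (1 - K) * (y\<^sup>2 / 2) + y + ln (1 - y)" for y :: real
  have deriv: "(g has_real_derivative y * (1 / (1 - K) - 1 / (1 - y))) (at y)" if "y \<le> K" for y
  proof -
    have "(g has_real_derivative 1 / (1 - K) * y + (1 - 1 / (1 - y))) (at y)"
    proof -
      have "((\<lambda>y. 1 / (1 - K) * (y\<^sup>2 / 2)) has_real_derivative 1 / (1 - K) * y) (at y)"
        by (rule DERIV_cmult) (auto intro!: derivative_eq_intros)
      moreover have "((\<lambda>y. y + ln (1 - y)) has_real_derivative 1 - 1 / (1 - y)) (at y)"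
        using that assms by (auto intro!: derivative_eq_intros)
      ultimately show ?thesis
        unfolding g_def add.assoc by (rule DERIV_add)
    qed
    moreover have "1 - 1 / (1 - y) = - y / (1 - y)"
      using that assms by (simp add: field_simps)
    ultimately show ?thesis by (simp add: right_diff_distrib)
  qed
  have le: "1 / (1 - y) \<le> 1 / (1 - K)" if "y \<le> K" for y
    using that assms by (intro divide_left_mono) auto
  have "g 0 \<le> g x"
  proof (cases "0 \<le> x")
    case True
    show ?thesis
    proof (rule DERIV_nonneg_imp_nondecreasing[OF True])
      fix y assume "0 \<le> y" "y \<le> x"
      then show "\<exists>D. (g has_real_derivative D) (at y) \<and> 0 \<le> D"
        using deriv[of y] le[of y] assms by (intro exI[of _ "y * (1 / (1 - K) - 1 / (1 - y))"] conjI) (auto intro!: mult_nonneg_nonneg)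
    qed
  next
    case False
    show ?thesis
    proof (rule DERIV_nonpos_imp_nonincreasing[of x 0 g])
      fix y assume "x \<le> y" "y \<le> 0"
      then show "\<exists>D. (g has_real_derivative D) (at y) \<and> D \<le> 0"
        using deriv[of y] le[of y] assms by (intro exI[of _ "y * (1 / (1 - K) - 1 / (1 - y))"] conjI) (auto intro!: mult_nonpos_nonneg)
    qed (use False in auto)
  qed
  moreover have "1 / (1 - K) * (x\<^sup>2 / 2) = x\<^sup>2 / (2 * (1 - K))"
    by (simp only: times_divide_times_eq mult_1 mult.commute)
  moreover have "g 0 = 0" by (simp add: g_def)
  ultimately show ?thesis unfolding g_def by linarith
qed

text \<open>The eigenvalue equation is read in the coordinate where \<open>v\<close> has its largest
  absolute value. The lemma is meant for \<open>A \<Sigma>\<close>, which is in general not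
  symmetric.\<close>

lemma eigenvalue_le_row_sum:
  fixes B :: "real^'n^'n"
  assumes v: "B *v v = c *\<^sub>R v" "v \<noteq> 0" and r: "\<And>k. (\<Sum>l\<in>UNIV. \<bar>B $ k $ l\<bar>) \<le> r"
  shows "\<bar>c\<bar> \<le> r"
proof -
  have "Max (range (\<lambda>l. \<bar>v $ l\<bar>)) \<in> range (\<lambda>l. \<bar>v $ l\<bar>)" by (rule Max_in) auto
  then obtain k where "\<bar>v $ k\<bar> = Max (range (\<lambda>l. \<bar>v $ l\<bar>))" by (metis imageE)
  then have k: "\<bar>v $ l\<bar> \<le> \<bar>v $ k\<bar>" for l by simp
  have "v $ k \<noteq> 0"
    using v(2) k by (metis abs_le_zero_iff abs_zero vec_eq_iff zero_index)
  have "\<bar>c\<bar> * \<bar>v $ k\<bar> = \<bar>\<Sum>l\<in>UNIV. B $ k $ l * v $ l\<bar>"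
    using arg_cong[OF v(1), of "\<lambda>x. x $ k"] by (simp add: matrix_vector_mult_def abs_mult)
  also have "\<dots> \<le> (\<Sum>l\<in>UNIV. \<bar>B $ k $ l\<bar> * \<bar>v $ l\<bar>)"
    unfolding abs_mult[symmetric] by (rule sum_abs)
  also have "\<dots> \<le> (\<Sum>l\<in>UNIV. \<bar>B $ k $ l\<bar> * \<bar>v $ k\<bar>)"
    by (intro sum_mono mult_left_mono k) auto
  also have "\<dots> \<le> r * \<bar>v $ k\<bar>"
    unfolding sum_distrib_right[symmetric] using r by (rule mult_right_mono) simp
  finally show ?thesis using \<open>v $ k \<noteq> 0\<close> by simp
qed

text \<open>The centring \<open>trace (A ** \<Sigma>)\<close> is the sum of the
  \<open>d $ i\<close>, so it can be distributed over the factors of the Laplace transform. Each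
  factor is then bounded separately, and the exponents add up to the sum of the squares of the
  \<open>d $ i\<close>.\<close>

lemma gaussian_quadratic_mgf_bound:
  fixes A \<Sigma> :: "real^'n^'n"
  assumes A: "transpose A = A" and \<Sigma>: "sym_pos_def \<Sigma>"
    and norm: "(\<integral>\<^sup>+x. ennreal (gaussian_density \<Sigma> x) \<partial>lborel) = 1"
    and F: "trace (A ** \<Sigma> ** (A ** \<Sigma>)) \<le> F"
    and R: "\<And>k. (\<Sum>l\<in>UNIV. \<bar>(A ** \<Sigma>) $ k $ l\<bar>) \<le> R"
    and \<theta>: "0 \<le> \<theta>" "2 * \<theta> * R \<le> K" "K < 1"
  shows "(\<integral>\<^sup>+x. ennreal (gaussian_density \<Sigma> x) * ennreal (exp (\<theta> * (x \<bullet> (A *v x) - trace (A ** \<Sigma>)))) \<partial>lborel)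
       \<le> ennreal (exp (\<theta>\<^sup>2 * F / (1 - K)))"
proof -
  obtain T :: "real^'n^'n" and d :: "real^'n" where T: "invertible T" "T ** transpose T = \<Sigma>"
    and diag: "transpose T ** A ** T = (\<chi> i j. if i = j then d $ i else 0)"
    using pos_def_congruence_diagonalization[OF A \<Sigma>] by blast
  have R0: "0 \<le> R" using R sum_nonneg[of UNIV] by (meson abs_ge_zero order_trans)
  then have K: "0 \<le> K" using \<theta> by (meson mult_nonneg_nonneg order_trans zero_le_numeral)
  \<comment> \<open>With \<Sigma> written as \<open>T T^t\<close>, cyclicity of the trace moves the
    last \<open>T^t\<close> to the front and produces the diagonal matrix.\<close>
  have "A ** \<Sigma> = (A ** T) ** transpose T" by (simp add: T(2)[symmetric] matrix_mul_assoc)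
  then have "trace (A ** \<Sigma>) = trace (transpose T ** A ** T)"
    by (metis matrix_mul_assoc trace_mul_sym)
  then have tr1: "trace (A ** \<Sigma>) = (\<Sum>i\<in>UNIV. d $ i)" by (simp add: diag trace_def)
  have "A ** \<Sigma> ** (A ** \<Sigma>) = (A ** T ** transpose T ** A ** T) ** transpose T"
    by (simp add: T(2)[symmetric] matrix_mul_assoc)
  then have "trace (A ** \<Sigma> ** (A ** \<Sigma>)) = trace ((transpose T ** A ** T) ** (transpose T ** A ** T))"
    by (metis matrix_mul_assoc trace_mul_sym)
  then have tr2: "trace (A ** \<Sigma> ** (A ** \<Sigma>)) = (\<Sum>i\<in>UNIV. (d $ i)\<^sup>2)"
    unfolding diag by (simp add: trace_def matrix_matrix_mult_def power2_eq_square if_distrib[of "\<lambda>x. x * _"] cong: if_cong)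
  have dR: "d $ i \<le> R" for i
  proof (cases "d $ i = 0")
    case True then show ?thesis using R0 by simp
  next
    case False
    \<comment> \<open>\<open>A T e\<^sub>i\<close> is an eigenvector of \<open>A \<Sigma>\<close> for the eigenvalue \<open>d\<^sub>i\<close>\<close>
    define v where "v = A *v column i T"
    have Tv: "transpose T *v v = d $ i *\<^sub>R axis i 1"
    proof -
      have "transpose T *v v = (transpose T ** A ** T) *v axis i 1"
        by (simp only: v_def matrix_vector_mul_assoc matrix_vector_mult_basis[symmetric] matrix_mul_assoc)
      also have "\<dots> = d $ i *\<^sub>R axis i 1"
        unfolding diag matrix_vector_mult_basis by (simp add: column_def vec_eq_iff axis_def)
      finally show ?thesis .
    qed
    then have "v \<noteq> 0" using False by (metis axis_eq_0_iff matrix_vector_mult_0_right scaleR_eq_0_iff zero_neq_one)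
    moreover have "(A ** \<Sigma>) *v v = d $ i *\<^sub>R v"
    proof -
      have "(A ** \<Sigma>) *v v = A *v (T *v (transpose T *v v))"
        by (simp only: T(2)[symmetric] matrix_vector_mul_assoc matrix_mul_assoc)
      then show ?thesis
        by (simp only: Tv matrix_vector_mult_scaleR matrix_vector_mult_basis) (simp only: v_def)
    qed
    ultimately have "\<bar>d $ i\<bar> \<le> R" using eigenvalue_le_row_sum R by blast
    then show ?thesis by simp
  qed
  have le: "2 * \<theta> * d $ i \<le> K" for i
    using \<theta> dR[of i] by (meson mult_left_mono mult_nonneg_nonneg order_trans zero_le_numeral)
  \<comment> \<open>The scalar bound at \<open>x = 2 * \<theta> * d $ i\<close>, halved because of
    the square root; the factors 2 combine to \<open>\<theta>^2 d^2 / (1 - K)\<close>.\<close>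
  have bound: "1 / sqrt (1 - 2 * \<theta> * d $ i) * exp (- \<theta> * d $ i) \<le> exp (\<theta>\<^sup>2 * (d $ i)\<^sup>2 / (1 - K))" for i
  proof -
    define x where "x = 2 * \<theta> * d $ i"
    have x: "x \<le> K" "x < 1" using le[of i] \<theta>(3) by (auto simp: x_def)
    have "1 / sqrt (1 - x) * exp (- \<theta> * d $ i) = exp ((- ln (1 - x) - x) / 2)"
      using x by (simp add: exp_diff exp_add exp_minus ln_sqrt[symmetric] diff_divide_distrib x_def field_simps)
    also have "\<dots> \<le> exp (x\<^sup>2 / (2 * (1 - K)) / 2)"
      unfolding exp_le_cancel_iff using neg_ln_one_minus_bound[OF x(1) K \<theta>(3)] by (rule divide_right_mono) simp
    also have "x\<^sup>2 / (2 * (1 - K)) / 2 = \<theta>\<^sup>2 * (d $ i)\<^sup>2 / (1 - K)"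
    proof -
      have "(2 * \<theta> * d $ i)\<^sup>2 / (2 * e) / 2 = \<theta>\<^sup>2 * (d $ i)\<^sup>2 / e" for e
        by (simp add: power_mult_distrib)
      then show ?thesis by (simp only: x_def)
    qed
    finally show ?thesis by (simp add: x_def)
  qed
  have [measurable]: "gaussian_density \<Sigma> \<in> borel_measurable borel"
    unfolding gaussian_density_def by measurable
  have "(\<integral>\<^sup>+x. ennreal (gaussian_density \<Sigma> x) * ennreal (exp (\<theta> * (x \<bullet> (A *v x) - trace (A ** \<Sigma>)))) \<partial>lborel)
     = (\<integral>\<^sup>+x. ennreal (gaussian_density \<Sigma> x) * ennreal (exp (\<theta> * (x \<bullet> (A *v x)))) * ennreal (exp (- (\<theta> * trace (A ** \<Sigma>)))) \<partial>lborel)"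
    by (simp add: right_diff_distrib exp_diff exp_minus divide_inverse ennreal_mult mult.assoc)
  also have "\<dots> = ennreal (\<Prod>i\<in>UNIV. 1 / sqrt (1 - 2 * \<theta> * d $ i)) * ennreal (exp (- (\<theta> * trace (A ** \<Sigma>))))"
    using gaussian_density_quadratic_mgf[OF T diag le_less_trans[OF le \<theta>(3)] norm]
    by (subst nn_integral_multc) auto
  also have "\<dots> = ennreal (\<Prod>i\<in>UNIV. 1 / sqrt (1 - 2 * \<theta> * d $ i) * exp (- \<theta> * d $ i))"
    unfolding prod.distrib tr1
    by (simp add: ennreal_mult'' exp_sum[symmetric] sum_negf sum_distrib_left)
  also have "\<dots> \<le> ennreal (\<Prod>i\<in>UNIV. exp (\<theta>\<^sup>2 * (d $ i)\<^sup>2 / (1 - K)))"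
  proof (intro ennreal_leI prod_mono conjI bound)
    fix i
    show "0 \<le> 1 / sqrt (1 - 2 * \<theta> * d $ i) * exp (- \<theta> * d $ i)"
      using le[of i] \<theta>(3) by simp
  qed
  also have "\<dots> = ennreal (exp (\<theta>\<^sup>2 * trace (A ** \<Sigma> ** (A ** \<Sigma>)) / (1 - K)))"
    by (simp add: tr2 exp_sum[symmetric] sum_distrib_left sum_divide_distrib)
  also have "\<dots> \<le> ennreal (exp (\<theta>\<^sup>2 * F / (1 - K)))"
    using F \<theta>(3) by (intro ennreal_leI) (auto intro!: divide_right_mono mult_left_mono)
  finally show ?thesis .
qed

section \<open>Tail bound\<close>

lemma \<phi>_sample_cov:
  fixes A :: "real^'n^'n"
  shows "\<phi> A (sample_cov n X \<omega> - \<Sigma>) = (\<Sum>m=1..n. X m \<omega> \<bullet> (A *v X m \<omega>)) / real n - trace (A ** \<Sigma>)"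
proof -
  have rank1: "trace (A ** (\<chi> k l. x $ k * x $ l)) = x \<bullet> (A *v x)" for x :: "real^'n"
    by (simp add: trace_def matrix_matrix_mult_def inner_vec_def matrix_vector_mult_def sum_distrib_left mult_ac)
  have tr_sum: "trace (A ** (\<Sum>m\<in>I. B m)) = (\<Sum>m\<in>I. trace (A ** B m))" if "finite I" for B :: "nat \<Rightarrow> real^'n^'n" and I
    using that by (induction I) (simp_all add: matrix_add_ldistrib trace_add trace_0[unfolded mat_0])
  have tr_scale: "trace (A ** (c *\<^sub>R B)) = c * trace (A ** B)" for B :: "real^'n^'n" and c
    by (simp add: trace_def matrix_matrix_mult_def sum_distrib_left mult_ac)
  have tr_diff: "trace (A ** (B - C)) = trace (A ** B) - trace (A ** C)" for B C :: "real^'n^'n"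
    by (simp add: trace_def matrix_matrix_mult_def right_diff_distrib sum_subtractf)
  show ?thesis
    by (simp add: \<phi>_def sample_cov_def tr_diff tr_scale tr_sum rank1)
qed

text \<open>Chernoff's method: independence multiplies the Laplace bounds, and Markov's inequality
  leaves the exponent \<open>n (\<theta> s - \<theta>^2 F / (1 - K))\<close>. The hypotheses
  \<open>s1\<close> and \<open>s2\<close> serve the two regimes of the choice of \<theta>.\<close>

lemma gaussian_quadratic_form_tail:
  fixes A \<Sigma> :: "real^'n^'n" and X :: "nat \<Rightarrow> 'a \<Rightarrow> real^'n"
  assumes iid: "iid_gaussian M n \<Sigma> X" and n: "n \<ge> 1"
    and A: "transpose A = A" and \<Sigma>: "sym_pos_def \<Sigma>"
    and F: "trace (A ** \<Sigma> ** (A ** \<Sigma>)) \<le> F" "F > 0"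
    and R: "\<And>k. (\<Sum>l\<in>UNIV. \<bar>(A ** \<Sigma>) $ k $ l\<bar>) \<le> R" "R > 0"
    and K: "0 < K" "K < 1" and u: "u > 0"
    and s1: "sqrt (u * F / ((1 - K) * real n)) \<le> s"
    and s2: "u * R / (K * real n) \<le> s"
  shows "measure M {\<omega> \<in> space M. \<phi> A (sample_cov n X \<omega> - \<Sigma>) \<ge> s} \<le> exp (- u / 4)"
proof -
  interpret prob_space M using iid by (simp add: iid_gaussian_def)
  have indep: "indep_vars (\<lambda>_. borel) X {1..n}"
    and dist: "\<And>m. m \<in> {1..n} \<Longrightarrow> distributed M lborel (X m) (\<lambda>x. ennreal (gaussian_density \<Sigma> x))"
    using iid by (auto simp: iid_gaussian_def)
  have [measurable]: "X m \<in> borel_measurable M" if "m \<in> {1..n}" for m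
    using distributed_measurable[OF dist[OF that]] by simp
  \<comment> \<open>The density integrates to 1 because it is the law of the first observation,
    which exists as \<open>n >= 1\<close>.\<close>
  have norm: "(\<integral>\<^sup>+x. ennreal (gaussian_density \<Sigma> x) \<partial>lborel) = 1"
    using distributed_nn_integral[OF dist[of 1], of "\<lambda>_. 1"] n by (simp add: emeasure_space_1)
  define q where "q x = x \<bullet> (A *v x) - trace (A ** \<Sigma>)" for x
  have q_meas [measurable]: "q \<in> borel_measurable borel" unfolding q_def by measurable
  have q: "\<phi> A (sample_cov n X \<omega> - \<Sigma>) = (\<Sum>m=1..n. q (X m \<omega>)) / real n" for \<omega>
    using n by (simp add: \<phi>_sample_cov q_def sum_subtractf diff_divide_distrib)
  have s: "s > 0" using u R K n by (intro less_le_trans[OF _ s2]) simp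
  \<comment> \<open>\<open>s * (1 - K) / (2 * F)\<close> maximises the exponent; the cap
    \<open>K / (2 * R)\<close> is what the Laplace bound allows.\<close>
  define \<theta> where "\<theta> = min (K / (2 * R)) (s * (1 - K) / (2 * F))"
  have \<theta>: "\<theta> > 0" using K R F s by (simp add: \<theta>_def)
  have \<theta>R: "2 * \<theta> * R \<le> K"
  proof -
    have "\<theta> \<le> K / (2 * R)" by (simp add: \<theta>_def)
    then show ?thesis using R(2) by (simp add: field_simps)
  qed
  have \<theta>F: "\<theta> * F / (1 - K) \<le> s / 2"
  proof -
    have "\<theta> \<le> s * (1 - K) / (2 * F)" by (simp add: \<theta>_def)
    then show ?thesis using F(2) K by (simp add: field_simps)
  qed
  have exponent: "u / 4 \<le> real n * (\<theta> * s - \<theta>\<^sup>2 * F / (1 - K))"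
  proof -
    \<comment> \<open>The quadratic term costs at most half of \<open>\<theta> * s\<close>, so half
      of the linear term has to reach \<open>u / 4\<close>. The capped value relies on
      \<open>s2\<close>, the unconstrained optimum on \<open>s1\<close>.\<close>
    have "u / 4 \<le> real n * (\<theta> * s / 2)"
    proof (cases "K / (2 * R) \<le> s * (1 - K) / (2 * F)")
      case True
      then have \<theta>K: "K = 2 * \<theta> * R" using R(2) by (simp add: \<theta>_def)
      have "u * R \<le> s * (K * real n)"
        using s2 K n by (simp add: pos_divide_le_eq)
      then have "R * u \<le> R * (2 * \<theta> * s * real n)" by (simp add: \<theta>K mult_ac)
      then have "u \<le> 2 * \<theta> * s * real n" using R(2) by simp
      then show ?thesis by (simp add: mult_ac)
    next
      case False
      then have \<theta>: "\<theta> = s * (1 - K) / (2 * F)" by (simp add: \<theta>_def)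
      have "u * F / ((1 - K) * real n) \<le> s\<^sup>2"
        using s1 s by (simp add: real_le_lsqrt sqrt_le_D)
      then have "u * F \<le> s\<^sup>2 * ((1 - K) * real n)"
        using K n by (simp add: pos_divide_le_eq)
      then show ?thesis using F(2) by (simp add: \<theta> field_simps power2_eq_square)
    qed
    moreover have "\<theta>\<^sup>2 * F / (1 - K) \<le> \<theta> * s / 2"
      using mult_left_mono[OF \<theta>F less_imp_le[OF \<theta>]] by (simp add: power2_eq_square)
    then have "real n * (\<theta> * s / 2) \<le> real n * (\<theta> * s - \<theta>\<^sup>2 * F / (1 - K))"
      by (intro mult_left_mono) auto
    ultimately show ?thesis by linarith
  qed
  define Y where "Y \<omega> = (\<Sum>m=1..n. q (X m \<omega>))" for \<omega>
  have [measurable]: "Y \<in> borel_measurable M" unfolding Y_def by measurable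
  have "(\<integral>\<^sup>+\<omega>. ennreal (exp (\<theta> * Y \<omega>)) \<partial>M) = (\<integral>\<^sup>+\<omega>. (\<Prod>m=1..n. ennreal (exp (\<theta> * q (X m \<omega>)))) \<partial>M)"
    by (simp add: Y_def sum_distrib_left exp_sum prod_ennreal)
  also have "\<dots> = (\<Prod>m=1..n. \<integral>\<^sup>+\<omega>. ennreal (exp (\<theta> * q (X m \<omega>))) \<partial>M)"
    by (intro indep_vars_nn_integral indep_vars_compose2[OF indep, where Y = "\<lambda>m x. ennreal (exp (\<theta> * q x))"]) auto
  also have "\<dots> \<le> (\<Prod>m=1..n. ennreal (exp (\<theta>\<^sup>2 * F / (1 - K))))"
  proof (intro prod_mono_ennreal)
    fix m assume m: "m \<in> {1..n}"
    have "(\<integral>\<^sup>+\<omega>. ennreal (exp (\<theta> * q (X m \<omega>))) \<partial>M)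
        = (\<integral>\<^sup>+x. ennreal (gaussian_density \<Sigma> x) * ennreal (exp (\<theta> * q x)) \<partial>lborel)"
      using distributed_nn_integral[OF dist[OF m], of "\<lambda>x. ennreal (exp (\<theta> * q x))"] by simp
    also have "\<dots> \<le> ennreal (exp (\<theta>\<^sup>2 * F / (1 - K)))"
      unfolding q_def by (rule gaussian_quadratic_mgf_bound[OF A \<Sigma> norm F(1) R(1) less_imp_le[OF \<theta>] \<theta>R K(2)])
    finally show "(\<integral>\<^sup>+\<omega>. ennreal (exp (\<theta> * q (X m \<omega>))) \<partial>M) \<le> ennreal (exp (\<theta>\<^sup>2 * F / (1 - K)))" .
  qed
  also have "\<dots> = ennreal (exp (real n * (\<theta>\<^sup>2 * F / (1 - K))))"
    by (simp add: ennreal_power exp_of_nat_mult del: times_divide_eq_right)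
  finally have mgf: "(\<integral>\<^sup>+\<omega>. ennreal (exp (\<theta> * Y \<omega>)) \<partial>M) \<le> ennreal (exp (real n * (\<theta>\<^sup>2 * F / (1 - K))))" .
  define E where "E = {\<omega> \<in> space M. \<phi> A (sample_cov n X \<omega> - \<Sigma>) \<ge> s}"
  have E: "E = {\<omega> \<in> space M. real n * s \<le> Y \<omega>}"
    using n by (auto simp: E_def q Y_def field_simps)
  have "emeasure M E = emeasure M {\<omega> \<in> space M. 1 \<le> ennreal (exp (- (\<theta> * (real n * s)))) * ennreal (exp (\<theta> * Y \<omega>))}"
    unfolding E using \<theta> by (simp add: ennreal_mult[symmetric] exp_add[symmetric] ennreal_1[symmetric] del: ennreal_1)
  also have "\<dots> \<le> ennreal (exp (- (\<theta> * (real n * s)))) * (\<integral>\<^sup>+\<omega>. ennreal (exp (\<theta> * Y \<omega>)) * indicator (space M) \<omega> \<partial>M)"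
    by (rule nn_integral_Markov_inequality) auto
  also have "(\<integral>\<^sup>+\<omega>. ennreal (exp (\<theta> * Y \<omega>)) * indicator (space M) \<omega> \<partial>M) = (\<integral>\<^sup>+\<omega>. ennreal (exp (\<theta> * Y \<omega>)) \<partial>M)"
    by (rule nn_integral_cong) simp
  also have "ennreal (exp (- (\<theta> * (real n * s)))) * \<dots>
      \<le> ennreal (exp (- (\<theta> * (real n * s)))) * ennreal (exp (real n * (\<theta>\<^sup>2 * F / (1 - K))))"
    using mgf by (rule mult_left_mono) simp
  also have "\<dots> = ennreal (exp (- (real n * (\<theta> * s - \<theta>\<^sup>2 * F / (1 - K)))))"
    by (simp add: ennreal_mult[symmetric] exp_add[symmetric] right_diff_distrib mult_ac)
  also have "\<dots> \<le> ennreal (exp (- u / 4))"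
    using exponent by (intro ennreal_leI) simp
  finally show ?thesis
    unfolding E_def[symmetric] emeasure_eq_measure by simp
qed

section \<open>Traces and row sums\<close>

lemma symmetric_matrix_entry:
  assumes "transpose A = A"
  shows "A $ l $ k = A $ k $ l"
  using assms by (metis transpose_def vec_lambda_beta)

text \<open>The form is tested on the sum and on the difference of two basis vectors.\<close>

lemma psd_matrix_entry_le:
  fixes C :: "real^'n^'n"
  assumes psd: "\<And>x. 0 \<le> x \<bullet> (C *v x)" and C: "transpose C = C"
  shows "\<bar>C $ k $ l\<bar> \<le> (C $ k $ k + C $ l $ l) / 2"
proof -
  have form: "(axis k 1 + c *\<^sub>R axis l 1) \<bullet> (C *v (axis k 1 + c *\<^sub>R axis l 1))
      = C $ k $ k + 2 * c * C $ k $ l + c\<^sup>2 * C $ l $ l" for c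
    by (simp add: matrix_vector_right_distrib matrix_vector_mult_scaleR matrix_vector_mult_basis inner_add_left
        inner_axis' column_def symmetric_matrix_entry[OF C, of l k] algebra_simps power2_eq_square)
  show ?thesis
    using psd[of "axis k 1 + 1 *\<^sub>R axis l 1"] psd[of "axis k 1 + (-1) *\<^sub>R axis l 1"]
    unfolding form by (simp add: abs_le_iff)
qed

text \<open>Off-diagonal entries of \<open>C\<close> are replaced by the mean of two diagonal ones.
  By symmetry of \<Sigma> both halves contribute equally, and each diagonal entry of
  \<open>C\<close> then meets a full row sum of \<Sigma>.\<close>

lemma trace_mult_psd_le_row_sum:
  fixes C \<Sigma> :: "real^'n^'n"
  assumes psd: "\<And>x. 0 \<le> x \<bullet> (C *v x)" and C: "transpose C = C" and \<Sigma>: "transpose \<Sigma> = \<Sigma>"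
    and r: "\<And>k. (\<Sum>l\<in>UNIV. \<bar>\<Sigma> $ k $ l\<bar>) \<le> r"
  shows "trace (C ** \<Sigma>) \<le> r * trace C"
proof -
  have sym: "\<Sigma> $ l $ k = \<Sigma> $ k $ l" for k l
    by (rule symmetric_matrix_entry[OF \<Sigma>])
  note entry = psd_matrix_entry_le[OF psd C]
  have diag: "0 \<le> C $ k $ k" for k using entry[of k k] by simp
  have "trace (C ** \<Sigma>) = (\<Sum>k\<in>UNIV. \<Sum>l\<in>UNIV. C $ k $ l * \<Sigma> $ k $ l)"
    by (simp add: trace_def matrix_matrix_mult_def sym)
  also have "\<dots> \<le> (\<Sum>k\<in>UNIV. \<Sum>l\<in>UNIV. (C $ k $ k + C $ l $ l) / 2 * \<bar>\<Sigma> $ k $ l\<bar>)"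
  proof (intro sum_mono)
    fix k l
    have "C $ k $ l * \<Sigma> $ k $ l \<le> \<bar>C $ k $ l\<bar> * \<bar>\<Sigma> $ k $ l\<bar>"
      by (metis abs_ge_self abs_mult)
    also have "\<dots> \<le> (C $ k $ k + C $ l $ l) / 2 * \<bar>\<Sigma> $ k $ l\<bar>"
      by (intro mult_right_mono entry) simp
    finally show "C $ k $ l * \<Sigma> $ k $ l \<le> (C $ k $ k + C $ l $ l) / 2 * \<bar>\<Sigma> $ k $ l\<bar>" .
  qed
  also have "\<dots> = (\<Sum>k\<in>UNIV. \<Sum>l\<in>UNIV. C $ k $ k * \<bar>\<Sigma> $ k $ l\<bar>)"
  proof -
    have "(\<Sum>k\<in>UNIV. \<Sum>l\<in>UNIV. C $ l $ l * \<bar>\<Sigma> $ k $ l\<bar>) = (\<Sum>k\<in>UNIV. \<Sum>l\<in>UNIV. C $ k $ k * \<bar>\<Sigma> $ k $ l\<bar>)"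
      by (subst sum.swap) (simp add: sym)
    moreover have "(C $ k $ k + C $ l $ l) / 2 * \<bar>\<Sigma> $ k $ l\<bar>
        = C $ k $ k * \<bar>\<Sigma> $ k $ l\<bar> / 2 + C $ l $ l * \<bar>\<Sigma> $ k $ l\<bar> / 2" for k l
      by (simp add: distrib_right add_divide_distrib)
    ultimately show ?thesis
      by (simp only: sum.distrib sum_divide_distrib[symmetric] field_sum_of_halves)
  qed
  also have "\<dots> \<le> (\<Sum>k\<in>UNIV. C $ k $ k * r)"
    unfolding sum_distrib_left[symmetric] by (intro sum_mono mult_left_mono r diag)
  also have "\<dots> = r * trace C" by (simp add: trace_def sum_distrib_left mult.commute)
  finally show ?thesis .
qed

text \<open>The trace bound is applied to \<open>C = A \<Sigma> A\<close> and to
  \<open>C = A A\<close>. Their forms at \<open>x\<close> are those of \<Sigma> and of the identity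
  at \<open>A x\<close>, hence nonnegative.\<close>

lemma trace_conjugated_square_le:
  fixes A \<Sigma> :: "real^'n^'n"
  assumes A: "transpose A = A" and \<Sigma>: "sym_pos_def \<Sigma>"
    and r: "\<And>k. (\<Sum>l\<in>UNIV. \<bar>\<Sigma> $ k $ l\<bar>) \<le> r"
  shows "trace (A ** \<Sigma> ** (A ** \<Sigma>)) \<le> r * trace (A ** A ** \<Sigma>)"
    and "trace (A ** A ** \<Sigma>) \<le> r * trace (A ** A)"
proof -
  have \<Sigma>t: "transpose \<Sigma> = \<Sigma>" and psd: "0 \<le> x \<bullet> (\<Sigma> *v x)" for x
    using \<Sigma> by (cases "x = 0"; fastforce simp: sym_pos_def_def intro: less_imp_le)+
  have "trace ((A ** \<Sigma> ** A) ** \<Sigma>) \<le> r * trace (A ** \<Sigma> ** A)"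
  proof (rule trace_mult_psd_le_row_sum[OF _ _ \<Sigma>t r])
    show "0 \<le> x \<bullet> ((A ** \<Sigma> ** A) *v x)" for x
      using psd[of "A *v x"] by (simp only: matrix_vector_mul_assoc[symmetric] inner_symmetric_matrix[OF A, of x])
    show "transpose (A ** \<Sigma> ** A) = A ** \<Sigma> ** A"
      by (simp add: matrix_transpose_mul A \<Sigma>t matrix_mul_assoc)
  qed
  moreover have "trace (A ** \<Sigma> ** A) = trace (A ** A ** \<Sigma>)"
    by (metis matrix_mul_assoc trace_mul_sym)
  ultimately show "trace (A ** \<Sigma> ** (A ** \<Sigma>)) \<le> r * trace (A ** A ** \<Sigma>)"
    by (simp add: matrix_mul_assoc)
  show "trace (A ** A ** \<Sigma>) \<le> r * trace (A ** A)"
  proof (rule trace_mult_psd_le_row_sum[OF _ _ \<Sigma>t r])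
    show "0 \<le> x \<bullet> ((A ** A) *v x)" for x
      by (simp only: matrix_vector_mul_assoc[symmetric] inner_symmetric_matrix[OF A, of x]) simp
    show "transpose (A ** A) = A ** A"
      by (simp add: matrix_transpose_mul A)
  qed
qed

text \<open>The maximal absolute row sum is the operator norm belonging to the maximum norm, hence
  submultiplicative.\<close>

lemma row_sum_mult:
  fixes A B :: "real^'n^'n"
  assumes a: "\<And>k. (\<Sum>l\<in>UNIV. \<bar>A $ k $ l\<bar>) \<le> a" and b: "\<And>k. (\<Sum>l\<in>UNIV. \<bar>B $ k $ l\<bar>) \<le> b"
  shows "(\<Sum>l\<in>UNIV. \<bar>(A ** B) $ k $ l\<bar>) \<le> a * b"
proof -
  have b0: "0 \<le> b" using b by (meson abs_ge_zero order_trans sum_nonneg)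
  have "(\<Sum>l\<in>UNIV. \<bar>(A ** B) $ k $ l\<bar>) \<le> (\<Sum>l\<in>UNIV. \<Sum>m\<in>UNIV. \<bar>A $ k $ m\<bar> * \<bar>B $ m $ l\<bar>)"
    unfolding abs_mult[symmetric] matrix_matrix_mult_def by (auto intro!: sum_mono sum_abs)
  also have "\<dots> = (\<Sum>m\<in>UNIV. \<bar>A $ k $ m\<bar> * (\<Sum>l\<in>UNIV. \<bar>B $ m $ l\<bar>))"
    by (subst sum.swap) (simp add: sum_distrib_left)
  also have "\<dots> \<le> (\<Sum>m\<in>UNIV. \<bar>A $ k $ m\<bar> * b)"
    by (intro sum_mono mult_left_mono b) auto
  also have "\<dots> \<le> a * b"
    unfolding sum_distrib_right[symmetric] using a b0 by (rule mult_right_mono)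
  finally show ?thesis .
qed

section \<open>Lag matrices and the Toeplitz class\<close>

lemma lag_commute: "lag k l = lag l k"
  by (auto simp: lag_def)

lemma pos_inject: "pos k = pos l \<longleftrightarrow> k = l"
  using strict_mono_pos by (rule strict_mono_eq)

lemma lag_eq_0_iff: "lag k l = 0 \<longleftrightarrow> k = l"
  by (auto simp: lag_def pos_inject)

lemma lag_less: "lag (k :: 'p::{finite,linorder}) l < CARD('p)"
proof -
  have "pos k \<in> {1..CARD('p)}" "pos l \<in> {1..CARD('p)}"
    using bij_betw_pos[where 'p = 'p] by (auto simp: bij_betw_def)
  then show ?thesis by (auto simp: lag_def)
qed

text \<open>The two candidate positions coincide for \<open>j = 0\<close>. Truncated subtraction can
  add a spurious position, but only an inclusion is needed.\<close>

lemma card_lag_row_le: "card {l. lag (k :: 'p::{finite,linorder}) l = j} \<le> (if j = 0 then 1 else 2)"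
proof -
  have "card {l. lag k l = j} = card (pos ` {l. lag k l = j})"
    by (simp add: card_image inj_on_def pos_inject)
  also have "\<dots> \<le> card {pos k + j, pos k - j}"
    by (intro card_mono) (auto simp: lag_def)
  also have "\<dots> \<le> (if j = 0 then 1 else 2)"
    by (simp add: card_insert_if)
  finally show ?thesis .
qed

text \<open>\<open>U\<close> holds the pairs whose second index comes \<open>j\<close> places after
  the first, which leaves \<open>p - j\<close> places for the first; swapping the indices covers the
  other sign.\<close>

lemma card_lag_pairs_le: "card {(k :: 'p::{finite,linorder}, l :: 'p). lag k l = j} \<le> 2 * (CARD('p) - j)"
proof -
  have pos_range: "pos k \<le> CARD('p)" "1 \<le> pos k" for k :: 'p
    using bij_betw_pos[where 'p = 'p] by (auto simp: bij_betw_def)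
  define U :: "('p \<times> 'p) set" where "U = {(k, l). pos l = pos k + j}"
  have "card U = card ((\<lambda>(k, l). pos k) ` U)"
    by (rule card_image[symmetric]) (auto simp: U_def inj_on_def pos_inject, metis pos_inject)
  also have "\<dots> \<le> card {1..CARD('p) - j}"
  proof (rule card_mono)
    show "(\<lambda>(k, l). pos k) ` U \<subseteq> {1..CARD('p) - j}"
    proof safe
      fix k l assume "(k, l) \<in> U"
      then have "pos k + j \<le> CARD('p)" using pos_range(1)[of l] by (simp add: U_def)
      then show "pos k \<in> {1..CARD('p) - j}" using pos_range(2)[of k] by simp
    qed
  qed simp
  finally have U: "card U \<le> CARD('p) - j" by simp
  have "{(k :: 'p, l :: 'p). lag k l = j} \<subseteq> U \<union> prod.swap ` U"
    by (auto simp: U_def lag_def image_iff)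
  then have "card {(k :: 'p, l :: 'p). lag k l = j} \<le> card (U \<union> prod.swap ` U)"
    by (intro card_mono) auto
  also have "\<dots> \<le> card U + card (prod.swap ` U)" by (rule card_Un_le)
  also have "\<dots> \<le> card U + card U" by (simp add: card_image_le)
  finally show ?thesis using U by simp
qed

lemma A_set_entry:
  assumes "finite W"
  shows "(A_set W :: real ^ ('p::{finite,linorder}) ^ ('p::{finite,linorder})) $ k $ l
       = (if lag k l \<in> W then 1 / (2 * (real CARD('p) - real (lag k l))) else 0)"
proof -
  have "(A_set W :: real ^ ('p::_) ^ ('p::_)) $ k $ l
      = (\<Sum>j\<in>W. if lag k l = j then 1 / (2 * (real CARD('p) - real j)) else 0)"
    by (simp add: A_set_def A_lag_def)
  then show ?thesis using assms by (simp add: sum.delta')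
qed

lemma transpose_A_set:
  assumes "finite W"
  shows "transpose (A_set W :: real ^ ('p::{finite,linorder}) ^ ('p::{finite,linorder})) = A_set W"
  by (simp add: vec_eq_iff transpose_def A_set_entry[OF assms] lag_commute)

text \<open>The row is grouped by lag: lag 0 occurs once and any other lag at most twice.\<close>

lemma sum_lag_row:
  fixes f :: "nat \<Rightarrow> real" and k :: "'p::{finite,linorder}"
  assumes "finite W" and "\<And>j. j \<in> W \<Longrightarrow> 0 \<le> f j"
  shows "(\<Sum>l\<in>UNIV. if lag k l \<in> W then f (lag k l) else 0) \<le> (\<Sum>j\<in>W. (if j = 0 then 1 else 2) * f j)"
proof -
  have "(\<Sum>l\<in>UNIV. if lag k l \<in> W then f (lag k l) else 0) = (\<Sum>l | lag k l \<in> W. f (lag k l))"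
    by (simp add: sum.inter_filter[symmetric])
  also have "\<dots> = (\<Sum>j\<in>W. \<Sum>l | lag k l \<in> W \<and> lag k l = j. f (lag k l))"
    using assms(1) by (subst sum.group[symmetric, of _ W "lag k"]) auto
  also have "\<dots> = (\<Sum>j\<in>W. real (card {l. lag k l = j}) * f j)"
  proof (rule sum.cong)
    fix j assume "j \<in> W"
    then have "{l. lag k l \<in> W \<and> lag k l = j} = {l. lag k l = j}" by auto
    then show "(\<Sum>l | lag k l \<in> W \<and> lag k l = j. f (lag k l)) = real (card {l. lag k l = j}) * f j"
      by simp
  qed simp
  also have "\<dots> \<le> (\<Sum>j\<in>W. (if j = 0 then 1 else 2) * f j)"
    using card_lag_row_le[of k] by (intro sum_mono mult_right_mono assms(2)) (force simp: of_nat_le_iff[symmetric] simp del: of_nat_le_iff split: if_splits)+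
  finally show ?thesis .
qed

text \<open>The same grouping over the whole matrix. The count \<open>2 (p - j)\<close> is the
  reciprocal of the entry of \<open>A_lag j\<close>, so each lag contributes total mass at most 1 to
  \<open>A_set W\<close>.\<close>

lemma sum_lag_pairs:
  fixes f :: "nat \<Rightarrow> real"
  assumes "finite W" and "\<And>j. j \<in> W \<Longrightarrow> 0 \<le> f j" and "\<And>j. j \<in> W \<Longrightarrow> j \<le> CARD('p)"
  shows "(\<Sum>k\<in>UNIV. \<Sum>l\<in>UNIV. if lag (k :: 'p::{finite,linorder}) (l :: 'p) \<in> W then f (lag k l) else 0)
       \<le> (\<Sum>j\<in>W. 2 * (real CARD('p) - real j) * f j)"
proof -
  define L :: "'p \<times> 'p \<Rightarrow> nat" where "L = (\<lambda>(k, l). lag k l)"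
  have "(\<Sum>k\<in>UNIV. \<Sum>l\<in>UNIV. if lag (k :: 'p) (l :: 'p) \<in> W then f (lag k l) else 0)
      = (\<Sum>x\<in>UNIV. if L x \<in> W then f (L x) else 0)"
    by (simp add: sum.cartesian_product L_def split_def cong: if_cong)
  also have "\<dots> = (\<Sum>x | L x \<in> W. f (L x))"
    by (simp add: sum.inter_filter[symmetric])
  also have "\<dots> = (\<Sum>j\<in>W. \<Sum>x | L x \<in> W \<and> L x = j. f (L x))"
    using assms(1) by (subst sum.group[symmetric, of _ W L]) auto
  also have "\<dots> = (\<Sum>j\<in>W. real (card {x. L x = j}) * f j)"
  proof (rule sum.cong)
    fix j assume "j \<in> W"
    then have "{x. L x \<in> W \<and> L x = j} = {x. L x = j}" by auto
    then show "(\<Sum>x | L x \<in> W \<and> L x = j. f (L x)) = real (card {x. L x = j}) * f j"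
      by simp
  qed simp
  also have "\<dots> \<le> (\<Sum>j\<in>W. 2 * (real CARD('p) - real j) * f j)"
  proof (intro sum_mono mult_right_mono assms(2))
    fix j assume "j \<in> W"
    have "{x. L x = j} = {(k, l). lag k l = j}" by (auto simp: L_def)
    then have "card {x. L x = j} \<le> 2 * (CARD('p) - j)"
      using card_lag_pairs_le[where 'p = 'p] by simp
    then have "real (card {x. L x = j}) \<le> real (2 * (CARD('p) - j))"
      by (rule of_nat_mono)
    then show "real (card {x. L x = j}) \<le> 2 * (real CARD('p) - real j)"
      using assms(3)[OF \<open>j \<in> W\<close>] by (simp add: of_nat_diff)
  qed
  finally show ?thesis .
qed

text \<open>A lag in \<open>W\<close> is not 0, so it contributes at most two entries
  \<open>1 / (2 (p - j))\<close> to a row.\<close>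

lemma A_set_row_sum:
  fixes k :: "'p::{finite,linorder}"
  assumes W: "W \<subseteq> {1..S}" and S: "S < CARD('p)"
  shows "(\<Sum>l\<in>UNIV. \<bar>(A_set W :: real ^ ('p::_) ^ ('p::_)) $ k $ l\<bar>) \<le> real (card W) / (real CARD('p) - real S)"
proof -
  have fin: "finite W" using W finite_subset by blast
  have lt: "j \<le> S" "j \<noteq> 0" if "j \<in> W" for j using that W by auto
  have "(\<Sum>l\<in>UNIV. \<bar>(A_set W :: real ^ ('p::_) ^ ('p::_)) $ k $ l\<bar>)
      = (\<Sum>l\<in>UNIV. if lag k l \<in> W then 1 / (2 * (real CARD('p) - real (lag k l))) else 0)"
    by (intro sum.cong refl) (use lag_less[of k] in \<open>auto simp: A_set_entry[OF fin] less_imp_le\<close>)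
  also have "\<dots> \<le> (\<Sum>j\<in>W. (if j = 0 then 1 else 2) * (1 / (2 * (real CARD('p) - real j))))"
    using fin lt(1) S by (intro sum_lag_row) force+
  also have "\<dots> \<le> (\<Sum>j\<in>W. 1 / (real CARD('p) - real S))"
  proof (rule sum_mono)
    fix j assume "j \<in> W"
    then have "(if j = 0 then 1 else 2) * (1 / (2 * x)) = 1 / x" for x :: real
      using lt(2)[OF \<open>j \<in> W\<close>] by simp
    moreover have "1 / (real CARD('p) - real j) \<le> 1 / (real CARD('p) - real S)"
      using lt(1)[OF \<open>j \<in> W\<close>] S by (intro divide_left_mono) auto
    ultimately show "(if j = 0 then 1 else 2) * (1 / (2 * (real CARD('p) - real j))) \<le> 1 / (real CARD('p) - real S)"
      by (simp only:)
  qed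
  also have "\<dots> = real (card W) / (real CARD('p) - real S)" by simp
  finally show ?thesis .
qed

text \<open>Lag \<open>j\<close> contributes at most \<open>2 (p - j)\<close> squares of
  \<open>1 / (2 (p - j))\<close>. The remaining factor 1/2 is the origin of the 2 in
  \<open>u / (2 * (1 - K))\<close>.\<close>

lemma trace_A_set_square:
  assumes W: "W \<subseteq> {1..S}" and S: "S < CARD('p::{finite,linorder})"
  shows "trace (A_set W ** A_set W :: real ^ ('p::{finite,linorder}) ^ ('p::{finite,linorder})) \<le> real (card W) / (2 * (real CARD('p) - real S))"
proof -
  have fin: "finite W" using W finite_subset by blast
  have lt: "j \<le> S" if "j \<in> W" for j using that W by auto
  have "trace (A_set W ** A_set W :: real ^ ('p::_) ^ ('p::_))
      = (\<Sum>k\<in>(UNIV::'p set). \<Sum>l\<in>(UNIV::'p set). if lag k l \<in> W then (1 / (2 * (real CARD('p) - real (lag k l))))\<^sup>2 else 0)"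
    unfolding trace_def matrix_matrix_mult_def
    by (simp add: A_set_entry[OF fin] lag_commute power2_eq_square if_distrib cong: if_cong)
  also have "\<dots> \<le> (\<Sum>j\<in>W. 2 * (real CARD('p) - real j) * (1 / (2 * (real CARD('p) - real j)))\<^sup>2)"
    using fin lt S by (intro sum_lag_pairs) force+
  also have "\<dots> \<le> (\<Sum>j\<in>W. 1 / (2 * (real CARD('p) - real S)))"
  proof (rule sum_mono)
    fix j assume "j \<in> W"
    then have j: "real j \<le> real S" "real S < real CARD('p)" using lt S by auto
    then have "2 * (real CARD('p) - real j) * (1 / (2 * (real CARD('p) - real j)))\<^sup>2 = 1 / (2 * (real CARD('p) - real j))"
      by (simp add: power2_eq_square)
    also have "\<dots> \<le> 1 / (2 * (real CARD('p) - real S))"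
      using j by (intro divide_left_mono) (auto intro!: mult_pos_pos)
    finally show "2 * (real CARD('p) - real j) * (1 / (2 * (real CARD('p) - real j)))\<^sup>2 \<le> 1 / (2 * (real CARD('p) - real S))" .
  qed
  also have "\<dots> = real (card W) / (2 * (real CARD('p) - real S))" by simp
  finally show ?thesis .
qed

section \<open>Entry and row-sum bounds for Toeplitz covariance matrices\<close>

lemma pos_def_diagonal:
  fixes \<Sigma> :: "real^'n^'n"
  assumes "sym_pos_def \<Sigma>"
  shows "0 < \<Sigma> $ k $ k"
proof -
  have "axis k 1 \<noteq> (0 :: real^'n)" by (simp add: axis_eq_0_iff)
  then have "0 < axis k 1 \<bullet> (\<Sigma> *v axis k 1)" using assms by (auto simp: sym_pos_def_def)
  then show ?thesis by (simp add: matrix_vector_mult_basis inner_axis' column_def)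
qed

lemma toeplitz_entry_le:
  fixes \<Sigma> :: "real ^ ('p::{finite,linorder}) ^ ('p::{finite,linorder})"
  assumes \<Sigma>: "sym_pos_def \<Sigma>" and T: "toeplitz \<Sigma>"
  shows "0 < toeplitz_coeff \<Sigma> 0" and "\<bar>\<Sigma> $ k $ l\<bar> \<le> toeplitz_coeff \<Sigma> 0"
proof -
  have t: "transpose \<Sigma> = \<Sigma>" using \<Sigma> by (simp add: sym_pos_def_def)
  have psd: "0 \<le> x \<bullet> (\<Sigma> *v x)" for x
    using \<Sigma> by (cases "x = 0") (auto simp: sym_pos_def_def less_imp_le)
  have diag: "\<Sigma> $ k $ k = toeplitz_coeff \<Sigma> 0" for k
    using toeplitz_coeff_lag[OF t T, of k k] by (simp add: lag_eq_0_iff[THEN iffD2])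
  show "0 < toeplitz_coeff \<Sigma> 0" using pos_def_diagonal[OF \<Sigma>, of k] diag by simp
  show "\<bar>\<Sigma> $ k $ l\<bar> \<le> toeplitz_coeff \<Sigma> 0"
    using psd_matrix_entry_le[OF psd t, of k l] by (simp add: diag)
qed

lemma F_class_row_sum:
  fixes \<Sigma> :: "real ^ ('p::{finite,linorder}) ^ ('p::{finite,linorder})"
  assumes "\<Sigma> \<in> F_class s S \<sigma>"
  shows "(\<Sum>l\<in>UNIV. \<bar>\<Sigma> $ k $ l\<bar>) \<le> toeplitz_coeff \<Sigma> 0 * (2 * real s + 1)"
proof -
  obtain J where \<Sigma>: "sym_pos_def \<Sigma>" "toeplitz \<Sigma>" and J: "J \<subseteq> {1..S}" "card J = s"
      and zero: "\<forall>j\<in>{1..CARD('p) - 1} - J. toeplitz_coeff \<Sigma> j = 0"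
    using assms by (auto simp: F_class_def)
  have fin: "finite J" using J(1) finite_subset by blast
  have t: "transpose \<Sigma> = \<Sigma>" using \<Sigma>(1) by (simp add: sym_pos_def_def)
  note c0 = toeplitz_entry_le(1)[OF \<Sigma>]
  \<comment> \<open>Only the diagonal and the \<open>s\<close> lags in \<open>J\<close> can be
    nonzero, and no entry exceeds the diagonal value; counting each nonzero lag twice gives
    \<open>2 s + 1\<close>.\<close>
  have "(\<Sum>l\<in>UNIV. \<bar>\<Sigma> $ k $ l\<bar>) \<le> (\<Sum>l\<in>UNIV. if lag k l \<in> insert 0 J then toeplitz_coeff \<Sigma> 0 else 0)"
  proof (rule sum_mono)
    fix l
    have "\<Sigma> $ k $ l = 0" if "lag k l \<notin> insert 0 J"
    proof -
      have "lag k l \<in> {1..CARD('p) - 1} - J" using that lag_less[of k l] by auto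
      then show ?thesis using zero toeplitz_coeff_lag[OF t \<Sigma>(2), of k l] by simp
    qed
    then show "\<bar>\<Sigma> $ k $ l\<bar> \<le> (if lag k l \<in> insert 0 J then toeplitz_coeff \<Sigma> 0 else 0)"
      using toeplitz_entry_le(2)[OF \<Sigma>, of k l] by (auto split: if_split)
  qed
  also have "\<dots> \<le> (\<Sum>j\<in>insert 0 J. (if j = 0 then 1 else 2) * toeplitz_coeff \<Sigma> 0)"
    using fin c0 by (intro sum_lag_row) auto
  also have "\<dots> = toeplitz_coeff \<Sigma> 0 + (\<Sum>j\<in>J. 2 * toeplitz_coeff \<Sigma> 0)"
  proof -
    have "0 \<notin> J" using J(1) by auto
    then have "(\<Sum>j\<in>J. (if j = 0 then 1 else 2) * toeplitz_coeff \<Sigma> 0) = (\<Sum>j\<in>J. 2 * toeplitz_coeff \<Sigma> 0)"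
      by (intro sum.cong) auto
    with fin \<open>0 \<notin> J\<close> show ?thesis by simp
  qed
  also have "\<dots> = toeplitz_coeff \<Sigma> 0 * (2 * real s + 1)" by (simp add: J(2) algebra_simps)
  finally show ?thesis .
qed

text \<open>Bounding the entries of \<Sigma> by the diagonal value, instead of using its row sums,
  replaces a factor \<open>(2 s + 1) / 2\<close> by 1. This pays off for a single lag, where the
  total mass of \<open>A\<close> is at most 1.\<close>

lemma trace_A_lag_square_mult:
  fixes \<Sigma> :: "real ^ ('p::{finite,linorder}) ^ ('p::{finite,linorder})"
  assumes \<Sigma>: "sym_pos_def \<Sigma>" "toeplitz \<Sigma>" and j: "1 \<le> j" "j \<le> S" and S: "S < CARD('p)"
  shows "trace (A_set {j} ** A_set {j} ** \<Sigma>) \<le> toeplitz_coeff \<Sigma> 0 / (real CARD('p) - real S)"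
proof -
  let ?A = "A_set {j} :: real ^ ('p::_) ^ ('p::_)"
  let ?c = "toeplitz_coeff \<Sigma> 0"
  have nonneg: "0 \<le> ?A $ k $ l" for k l
    using j S by (simp add: A_set_entry)
  have c0: "0 < ?c" by (rule toeplitz_entry_le(1)[OF \<Sigma>])
  have row: "(\<Sum>l\<in>UNIV. ?A $ k $ l) \<le> 1 / (real CARD('p) - real S)" for k
    using A_set_row_sum[of "{j}" S k] j S nonneg by simp
  have total: "(\<Sum>k\<in>UNIV. \<Sum>l\<in>UNIV. ?A $ k $ l) \<le> 1"
    using sum_lag_pairs[of "{j}" "\<lambda>j. 1 / (2 * (real CARD('p) - real j))", where 'p = 'p] j S
    by (simp add: A_set_entry cong: if_cong)
  have "trace (?A ** ?A ** \<Sigma>) = (\<Sum>k\<in>UNIV. \<Sum>l\<in>UNIV. (\<Sum>m\<in>UNIV. ?A $ k $ m * ?A $ m $ l) * \<Sigma> $ l $ k)"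
    by (simp add: trace_def matrix_matrix_mult_def)
  also have "\<dots> \<le> (\<Sum>k\<in>UNIV. \<Sum>l\<in>UNIV. (\<Sum>m\<in>UNIV. ?A $ k $ m * ?A $ m $ l) * ?c)"
    using nonneg toeplitz_entry_le(2)[OF \<Sigma>]
    by (intro sum_mono mult_left_mono sum_nonneg mult_nonneg_nonneg) (auto intro: abs_le_D1)
  \<comment> \<open>Summing over \<open>l\<close> first splits the mass of \<open>A A\<close> into
    the total mass of \<open>A\<close> times a row sum of \<open>A\<close>.\<close>
  also have "\<dots> = (\<Sum>k\<in>UNIV. \<Sum>m\<in>UNIV. ?A $ k $ m * (\<Sum>l\<in>UNIV. ?A $ m $ l)) * ?c"
  proof -
    have "(\<Sum>l\<in>UNIV. \<Sum>m\<in>UNIV. ?A $ k $ m * ?A $ m $ l) = (\<Sum>m\<in>UNIV. ?A $ k $ m * (\<Sum>l\<in>UNIV. ?A $ m $ l))" for k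
      by (subst sum.swap) (simp only: sum_distrib_left)
    then show ?thesis by (simp only: sum_distrib_right[symmetric])
  qed
  also have "\<dots> \<le> (\<Sum>k\<in>UNIV. \<Sum>m\<in>UNIV. ?A $ k $ m * (1 / (real CARD('p) - real S))) * ?c"
    using c0 nonneg by (intro mult_right_mono sum_mono mult_left_mono row) auto
  also have "\<dots> = (\<Sum>k\<in>UNIV. \<Sum>m\<in>UNIV. ?A $ k $ m) * (?c / (real CARD('p) - real S))"
    by (simp add: sum_divide_distrib[symmetric])
  also have "\<dots> \<le> 1 * (?c / (real CARD('p) - real S))"
    using c0 S by (intro mult_right_mono total) auto
  finally show ?thesis by simp
qed

section \<open>Matching the variance and row-sum bounds with the thresholds\<close>

theorem corollary2p4:
  fixes n p s S w :: nat and \<sigma> K :: real and W :: "nat set"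
    and M :: "'a measure" and X :: "nat \<Rightarrow> 'a \<Rightarrow> real ^ ('p::{finite,linorder})"
    and t t' :: "real \<Rightarrow> real"
  assumes "n \<ge> 1" and "p = CARD('p)"
    and "1 \<le> s" and "s \<le> S" and "real S < real p / 2"
    and "\<sigma> > 0"
    and "W \<subseteq> {1..S}" and "card W = w" and "w \<ge> 1"
    and "0 < K" and "K < 1"
    and t: "\<And>u. u > 0 \<Longrightarrow> t u =
          max (sqrt (u / (2 * (1 - K))) * sqrt (real w / (real n * (real p - real S))))
              (u / K * (real w / (real n * (real p - real S))))"
    and t': "\<And>u. u > 0 \<Longrightarrow> t' u =
          (if w = 1
           then max (sqrt (u / (1 - K)) * sqrt ((2 * real s + 1) / (real n * (real p - real S))))
                    (u / K * ((2 * real s + 1) / (real n * (real p - real S))))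
           else (2 * real s + 1) * t u)"
  shows "(iid_gaussian M n (mat 1) X \<longrightarrow>
           (\<forall>u>0. measure M {\<omega> \<in> space M.
                \<phi> (A_set W) (sample_cov n X \<omega> - mat 1)
                  \<ge> toeplitz_coeff (mat 1 :: real ^ ('p::{finite,linorder}) ^ ('p::{finite,linorder})) 0 * t u}
              \<le> exp (- u / 4))) \<and>
         (\<forall>\<Sigma> \<in> F_class s S \<sigma>. iid_gaussian M n \<Sigma> X \<longrightarrow>
           (\<forall>u>0. measure M {\<omega> \<in> space M.
                \<phi> (A_set W) (sample_cov n X \<omega> - \<Sigma>) \<ge> toeplitz_coeff \<Sigma> 0 * t' u}
              \<le> exp (- u / 4)))"
proof -
  let ?A = "A_set W :: real ^ ('p::_) ^ ('p::_)"
  define D where "D = real p - real S"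
  have S: "S < CARD('p)" and D: "D > 0" using assms(2,5) by (auto simp: D_def)
  have n: "real n > 0" and w: "real w > 0" using assms(1,9) by auto
  have fin: "finite W" using assms(7) finite_subset by blast
  have A: "transpose ?A = ?A" using fin by (rule transpose_A_set)
  have rowA: "(\<Sum>l\<in>UNIV. \<bar>?A $ k $ l\<bar>) \<le> real w / D" for k
    using A_set_row_sum[OF assms(7) S] by (simp add: assms(2,8) D_def)
  have trA: "trace (?A ** ?A) \<le> real w / (2 * D)"
    using trace_A_set_square[OF assms(7) S] by (simp add: assms(2,8) D_def)
  \<comment> \<open>For the identity \<open>A \<Sigma>\<close> is \<open>A\<close> itself, and the
    bounds on \<open>trace (A A)\<close> and on the row sums of \<open>A\<close> give exactly the
    two parts of \<open>t\<close>.\<close>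
  have identity: "measure M {\<omega> \<in> space M. \<phi> ?A (sample_cov n X \<omega> - mat 1) \<ge> t u} \<le> exp (- u / 4)"
    if iid: "iid_gaussian M n (mat 1) X" and u: "u > 0" for u
  proof (rule gaussian_quadratic_form_tail[OF iid assms(1) A])
    show "sym_pos_def (mat 1 :: real ^ ('p::_) ^ ('p::_))" by (simp add: sym_pos_def_def)
    show "trace (?A ** mat 1 ** (?A ** mat 1)) \<le> real w / (2 * D)" using trA by simp
    show "(\<Sum>l\<in>UNIV. \<bar>(?A ** mat 1) $ k $ l\<bar>) \<le> real w / D" for k using rowA by simp
    have "u * (real w / (2 * D)) / ((1 - K) * real n) = u / (2 * (1 - K)) * (real w / (real n * D))"
      by simp
    then show "sqrt (u * (real w / (2 * D)) / ((1 - K) * real n)) \<le> t u"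
      by (simp only: t[OF u] D_def[symmetric] real_sqrt_mult max.cobounded1)
    have "u * (real w / D) / (K * real n) = u / K * (real w / (real n * D))" by simp
    then show "u * (real w / D) / (K * real n) \<le> t u"
      by (simp only: t[OF u] D_def[symmetric] max.cobounded2)
  qed (use D w u assms(10,11) in auto)
  have general: "measure M {\<omega> \<in> space M. \<phi> ?A (sample_cov n X \<omega> - \<Sigma>) \<ge> toeplitz_coeff \<Sigma> 0 * t' u} \<le> exp (- u / 4)"
    if F: "\<Sigma> \<in> F_class s S \<sigma>" and iid: "iid_gaussian M n \<Sigma> X" and u: "u > 0" for \<Sigma> u
  proof -
    define c r where "c = toeplitz_coeff \<Sigma> 0" and "r = 2 * real s + 1"
    have \<Sigma>: "sym_pos_def \<Sigma>" "toeplitz \<Sigma>" using F by (auto simp: F_class_def)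
    have c: "c > 0" using toeplitz_entry_le(1)[OF \<Sigma>] by (simp add: c_def)
    have r: "r > 0" by (simp add: r_def)
    have row\<Sigma>: "(\<Sum>l\<in>UNIV. \<bar>\<Sigma> $ k $ l\<bar>) \<le> c * r" for k
      using F_class_row_sum[OF F] by (simp add: c_def r_def)
    have row: "(\<Sum>l\<in>UNIV. \<bar>(?A ** \<Sigma>) $ k $ l\<bar>) \<le> real w / D * (c * r)" for k
      using rowA row\<Sigma> by (rule row_sum_mult)
    note tr = trace_conjugated_square_le[OF A \<Sigma>(1) row\<Sigma>]
    \<comment> \<open>The row-sum bound of \<open>A \<Sigma>\<close> is the product of those of
      \<open>A\<close> and \<Sigma>; in both cases it yields \<open>c r\<close> times the linear
      part of \<open>t\<close>.\<close>
    have R: "u * (real w / D * (c * r)) / (K * real n) = c * (r * (u / K * (real w / (real n * D))))"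
      by (simp add: mult_ac)
    show ?thesis unfolding c_def[symmetric]
    proof (cases "w = 1")
      case True
      then obtain j where W: "W = {j}" using assms(8) card_1_singletonE by blast
      have t'u: "t' u = max (sqrt (u / (1 - K)) * sqrt (r / (real n * D))) (u / K * (r / (real n * D)))"
        using True by (simp add: t'[OF u] r_def D_def)
      \<comment> \<open>One factor \<open>r\<close> comes from the row sums of \<Sigma>, while the
        remaining trace costs only \<open>c / D\<close>. Hence \<open>sqrt r\<close>, and not
        \<open>r\<close>, stands in the square-root part of \<open>t'\<close>.\<close>
      have "trace (?A ** ?A ** \<Sigma>) \<le> c / D"
        using trace_A_lag_square_mult[OF \<Sigma>, of j S] assms(7) S by (simp add: W c_def D_def assms(2))
      then have "c * r * trace (?A ** ?A ** \<Sigma>) \<le> c * r * (c / D)"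
        using c r by (intro mult_left_mono) auto
      then have trF: "trace (?A ** \<Sigma> ** (?A ** \<Sigma>)) \<le> c * r * (c / D)" using tr(1) by linarith
      have "u * (c * r * (c / D)) / ((1 - K) * real n) = c\<^sup>2 * (u / (1 - K) * (r / (real n * D)))"
        by (simp add: power2_eq_square mult_ac)
      then have eq: "sqrt (u * (c * r * (c / D)) / ((1 - K) * real n)) = c * (sqrt (u / (1 - K)) * sqrt (r / (real n * D)))"
        using c by (simp only: real_sqrt_mult real_sqrt_abs abs_of_pos)
      have s1: "sqrt (u * (c * r * (c / D)) / ((1 - K) * real n)) \<le> c * t' u"
        unfolding eq t'u using c by (intro mult_left_mono) auto
      have "r * (u / K * (real w / (real n * D))) \<le> t' u" unfolding t'u by (simp add: True mult_ac)
      then have s2: "u * (real w / D * (c * r)) / (K * real n) \<le> c * t' u"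
        unfolding R using c by (intro mult_left_mono) auto
      show "measure M {\<omega> \<in> space M. \<phi> ?A (sample_cov n X \<omega> - \<Sigma>) \<ge> c * t' u} \<le> exp (- u / 4)"
        using c r D w u assms(10,11)
        by (intro gaussian_quadratic_form_tail[OF iid assms(1) A \<Sigma>(1) trF _ row _ _ _ _ s1 s2]) auto
    next
      case False
      have t'u: "t' u = r * t u" using False by (simp add: t'[OF u] r_def)
      \<comment> \<open>For several lags the row sums bound both factors \<Sigma>, so
        \<open>c r\<close> enters squared and leaves the root as the factor \<open>2 s + 1\<close>
        in front of \<open>t\<close>.\<close>
      have "trace (?A ** ?A ** \<Sigma>) \<le> c * r * (real w / (2 * D))"
        using tr(2) mult_left_mono[OF trA, of "c * r"] c r by auto
      then have "c * r * trace (?A ** ?A ** \<Sigma>) \<le> c * r * (c * r * (real w / (2 * D)))"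
        using c r by (intro mult_left_mono) auto
      then have trF: "trace (?A ** \<Sigma> ** (?A ** \<Sigma>)) \<le> c * r * (c * r * (real w / (2 * D)))"
        using tr(1) by linarith
      have "u * (c * r * (c * r * (real w / (2 * D)))) / ((1 - K) * real n)
          = (c * r)\<^sup>2 * (u / (2 * (1 - K)) * (real w / (real n * D)))"
        by (simp add: power2_eq_square mult_ac)
      then have eq: "sqrt (u * (c * r * (c * r * (real w / (2 * D)))) / ((1 - K) * real n))
          = c * r * (sqrt (u / (2 * (1 - K))) * sqrt (real w / (real n * D)))"
        using c r by (simp only: real_sqrt_mult real_sqrt_abs abs_of_pos mult_pos_pos)
      have s1: "sqrt (u * (c * r * (c * r * (real w / (2 * D)))) / ((1 - K) * real n)) \<le> c * t' u"
        unfolding eq unfolding t'u t[OF u] D_def[symmetric] mult.assoc using c r by (intro mult_left_mono) auto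
      have s2: "u * (real w / D * (c * r)) / (K * real n) \<le> c * t' u"
        unfolding R t'u t[OF u] D_def[symmetric] using c r by (intro mult_left_mono) auto
      show "measure M {\<omega> \<in> space M. \<phi> ?A (sample_cov n X \<omega> - \<Sigma>) \<ge> c * t' u} \<le> exp (- u / 4)"
        using c r D w u assms(10,11)
        by (intro gaussian_quadratic_form_tail[OF iid assms(1) A \<Sigma>(1) trF _ row _ _ _ _ s1 s2]) auto
    qed
  qed
  show ?thesis
    using identity general by (simp add: toeplitz_coeff_mat_1)
qed

end
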